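(* Let $\omega\in\mathbb W_d$ be a doubling weight with lower dilation index $i_\omega>0$. Let $\mathcal B$ be an unconditional M-basis of a quasi-Banach space $\mathbb X$. (1) If $\mathcal B$ is greedy, then $\mathcal A_q^\omega\approx\mathcal G_q^\omega$ for all $q\in(0,\infty]$. (2) If $\mathcal A_q^\omega\approx\mathcal G_q^\omega$ for some $q\in(0,\infty]$, then $\mathcal B$ is greedy.
   Context: Spaces and bases. A quasi-Banach space $(\mathbb X,\|\cdot\|)$ over $\mathbb F=\mathbb R$ or $\mathbb C$ is a complete vector space with a quasi-norm: $\|x\|=0$ iff $x=0$; $\|tx\|=|t|\|x\|$; $\|x+y\|\le\kappa(\|x\|+\|y\|)$ for some $\kappa\ge1$. An M-basis (or simply basis) of $\mathbb X$ is a sequence $\mathcal B=(e_n)_{n\ge1}$ for which there are functionals $(e_n^* )\subset\mathbb X^*$ with $e_i^*(e_j)=\delta_{i,j}$; $0<c_1\le\|e_n\|,\|e_n^*\|_*\le c_2<\infty$ for all $n$; $\overline{\mathrm{span}\{e_n\}}=\mathbb X$; and $e_n^*(x)=0$ for all $n$ implies $x=0$. $\mathcal B$ is unconditional if $\sup\{\|P_A\|:A\subset\mathbb N,|A|<\infty\}<\infty$, where $P_A(x)=\sum_{n\in A}e_n^*(x)e_n$. Errors. Put $\mathrm{supp}(x)=\{n:e_n^*(x)\ne0\}$. A greedy ordering of $x$ is an injective map $\pi:\mathbb N\to\mathbb N$ with $\mathrm{supp}(x)\subset\pi(\mathbb N)$ and $|e^*_{\pi(i)}(x)|\ge|e^*_{\pi(j)}(x)|$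 whenever $i\le j$. For $m\in\mathbb N$, $\sigma_m(x)=\inf\{\|x-\sum_{n\in A}b_ne_n\|:|A|=m,\ b_n\in\mathbb F\}$ and $\gamma_m(x)=\sup_\pi\|x-\sum_{n=1}^m e^*_{\pi(n)}(x)e_{\pi(n)}\|$, the supremum over all greedy orderings $\pi$ of $x$. $\mathcal B$ is greedy if $\gamma_m(x)\asymp\sigma_m(x)$, i.e. the two quantities are equivalent up to constants independent of $x\in\mathbb X$ and $m\in\mathbb N$. Weights. $\mathbb W$ is the set of sequences $\omega=(\omega(n))_{n\ge1}$ with $0<\omega(1)\le\omega(2)\le\cdots$ and $\omega(n)\to\infty$. $\mathbb W_d$ (doubling weights) is the set of $\omega\in\mathbb W$ for which there is $\theta\ge1$ with $\omega(2n)\le\theta\,\omega(n)$ for all $n$. For $\omega\in\mathbb W$, $\varphi_\omega(M)=\inf_{k\ge1}\omega(Mk)/\omega(k)$ and $i_\omega=\sup_{M>1}\ln\varphi_\omega(M)/\ln M$ ($M$ ranging over integers). Classes. For $0<q<\infty$, $\|x\|_{\mathcal A_q^\omega}=\|x\|+\big[\sum_{n\ge1}(\omega(n)\sigma_n(x))^q\frac1n\big]^{1/q}$, and $\|x\|_{\mathcal A_\infty^\omega}=\|x\|+\sup_{n\ge1}\omega(n)\sigma_n(x)$; $\mathcal A_q^\omega$ is the set of $x\in\mathbb X$ for which this is finite. $\mathcal G_q^\omega$ is defined in the same way with $\gamma_n$ in place of $\sigma_n$. For two such classes, $X\hookrightarrow Y$ means $X\subset Y$ and there is $C>0$ with $\|x\|_Y\le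 C\|x\|_X$ for all $x\in X$; $X\approx Y$ means $X\hookrightarrow Y$ and $Y\hookrightarrow X$. *)

theory Defs
  imports "HOL-Analysis.Analysis"
begin

text \<open>
  The scalar field is an arbitrary type of sort \<open>{real_normed_field, heine_borel}\<close>. Both
  \<open>real\<close> and \<open>complex\<close> have this sort, and by the Gelfand-Mazur theorem (the norm of a
  \<open>real_normed_field\<close> is multiplicative) every such field is isometrically isomorphic to one
  of these two.
  A quasi-norm does not fit the class \<open>real_normed_vector\<close>, so the quasi-norm and the scalar
  multiplication are explicit parameters on an abelian group type.
\<close>

locale quasi_banach_space = vector_space smul
  for smul :: "'k::{real_normed_field, heine_borel} \<Rightarrow> 'v::ab_group_add \<Rightarrow> 'v" +
  fixes qnorm :: "'v \<Rightarrow> real"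
  assumes qnorm_nonneg: "0 \<le> qnorm x"
    and qnorm_eq_0_iff: "qnorm x = 0 \<longleftrightarrow> x = 0"
    and qnorm_smul: "qnorm (smul t x) = norm t * qnorm x"
    and qnorm_triangle: "\<exists>\<kappa>\<ge>1. \<forall>x y. qnorm (x + y) \<le> \<kappa> * (qnorm x + qnorm y)"
    and complete:
      "(\<forall>\<epsilon>>0. \<exists>M. \<forall>m\<ge>M. \<forall>n\<ge>M. qnorm (u m - u n) < \<epsilon>) \<Longrightarrow>
        \<exists>l. (\<lambda>n. qnorm (u n - l)) \<longlonglongrightarrow> 0"

definition dual_space ::
    "('k::real_normed_field \<Rightarrow> 'v::ab_group_add \<Rightarrow> 'v) \<Rightarrow> ('v \<Rightarrow> real) \<Rightarrow> ('v \<Rightarrow> 'k) set" where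
  "dual_space smul qnorm =
    {f. Vector_Spaces.linear smul (*) f \<and> (\<exists>C. \<forall>x. norm (f x) \<le> C * qnorm x)}"

definition dual_norm :: "('v \<Rightarrow> real) \<Rightarrow> ('v \<Rightarrow> 'k::real_normed_field) \<Rightarrow> ennreal" where
  "dual_norm qnorm f = (SUP x\<in>{x. qnorm x \<le> 1}. ennreal (norm (f x)))"

definition operator_qnorm :: "('v \<Rightarrow> real) \<Rightarrow> ('v \<Rightarrow> 'v) \<Rightarrow> ennreal" where
  "operator_qnorm qnorm T = (SUP x\<in>{x. qnorm x \<le> 1}. ennreal (qnorm (T x)))"

text \<open>
  Bases are indexed by \<open>{0, 1, \<dots>}\<close> instead of \<open>{1, 2, \<dots>}\<close>; this is a mere relabelling,
  since none of the notions below depends on the labels of the basis vectors. Weights and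
  approximation errors, where the value of the index matters, are used at positive indices only.
  The coefficient functionals \<open>e'\<close> are uniquely determined by \<open>e\<close>, because the span of \<open>e\<close> is
  dense and they are continuous; hence they can be carried along as a parameter.
\<close>

locale M_basis = quasi_banach_space smul qnorm
  for smul :: "'k::{real_normed_field, heine_borel} \<Rightarrow> 'v::ab_group_add \<Rightarrow> 'v"
    and qnorm :: "'v \<Rightarrow> real" +
  fixes e :: "nat \<Rightarrow> 'v" and e' :: "nat \<Rightarrow> 'v \<Rightarrow> 'k"
  assumes functionals: "e' n \<in> dual_space smul qnorm"
    and biorthogonal: "e' i (e j) = (if i = j then 1 else 0)"
    and seminormalized: "\<exists>c1>0. \<exists>c2. \<forall>n. c1 \<le> qnorm (e n) \<and> qnorm (e n) \<le> c2 \<and>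
      ennreal c1 \<le> dual_norm qnorm (e' n) \<and> dual_norm qnorm (e' n) \<le> ennreal c2"
    and dense_span: "\<forall>x. \<forall>\<epsilon>>0. \<exists>y\<in>span (range e). qnorm (x - y) < \<epsilon>"
    and total: "(\<forall>n. e' n x = 0) \<Longrightarrow> x = 0"

definition basis_projection ::
    "('k \<Rightarrow> 'v::ab_group_add \<Rightarrow> 'v) \<Rightarrow> (nat \<Rightarrow> 'v) \<Rightarrow> (nat \<Rightarrow> 'v \<Rightarrow> 'k) \<Rightarrow> nat set \<Rightarrow> 'v \<Rightarrow> 'v" where
  "basis_projection smul e e' A x = (\<Sum>n\<in>A. smul (e' n x) (e n))"

definition unconditional_basis ::
    "('k \<Rightarrow> 'v::ab_group_add \<Rightarrow> 'v) \<Rightarrow> ('v \<Rightarrow> real) \<Rightarrow> (nat \<Rightarrow> 'v) \<Rightarrow> (nat \<Rightarrow> 'v \<Rightarrow> 'k) \<Rightarrow> bool" where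
  "unconditional_basis smul qnorm e e' \<longleftrightarrow>
    (SUP A\<in>{A. finite A}. operator_qnorm qnorm (basis_projection smul e e' A)) < \<infinity>"

definition basis_support :: "(nat \<Rightarrow> 'v \<Rightarrow> 'k::zero) \<Rightarrow> 'v \<Rightarrow> nat set" where
  "basis_support e' x = {n. e' n x \<noteq> 0}"

definition greedy_ordering ::
    "(nat \<Rightarrow> 'v \<Rightarrow> 'k::real_normed_field) \<Rightarrow> 'v \<Rightarrow> (nat \<Rightarrow> nat) \<Rightarrow> bool" where
  "greedy_ordering e' x \<pi> \<longleftrightarrow> inj \<pi> \<and> basis_support e' x \<subseteq> range \<pi> \<and>
    (\<forall>i j. i \<le> j \<longrightarrow> norm (e' (\<pi> i) x) \<ge> norm (e' (\<pi> j) x))"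

definition best_error ::
    "('k \<Rightarrow> 'v::ab_group_add \<Rightarrow> 'v) \<Rightarrow> ('v \<Rightarrow> real) \<Rightarrow> (nat \<Rightarrow> 'v) \<Rightarrow> nat \<Rightarrow> 'v \<Rightarrow> real" where
  "best_error smul qnorm e m x =
    Inf {qnorm (x - (\<Sum>n\<in>A. smul (b n) (e n))) | A b. finite A \<and> card A = m}"

text \<open>
  For an M-basis the supremum is over a finite nonempty set of values: coefficients tend to \<open>0\<close>,
  so greedy orderings exist and only finitely many initial segments of length \<open>m\<close> with nonzero
  coefficients are possible.
\<close>

definition greedy_error ::
    "('k::real_normed_field \<Rightarrow> 'v::ab_group_add \<Rightarrow> 'v) \<Rightarrow> ('v \<Rightarrow> real) \<Rightarrow> (nat \<Rightarrow> 'v) \<Rightarrow>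
      (nat \<Rightarrow> 'v \<Rightarrow> 'k) \<Rightarrow> nat \<Rightarrow> 'v \<Rightarrow> real" where
  "greedy_error smul qnorm e e' m x =
    (SUP \<pi>\<in>{\<pi>. greedy_ordering e' x \<pi>}. qnorm (x - (\<Sum>i<m. smul (e' (\<pi> i) x) (e (\<pi> i)))))"

definition greedy_basis ::
    "('k::real_normed_field \<Rightarrow> 'v::ab_group_add \<Rightarrow> 'v) \<Rightarrow> ('v \<Rightarrow> real) \<Rightarrow> (nat \<Rightarrow> 'v) \<Rightarrow>
      (nat \<Rightarrow> 'v \<Rightarrow> 'k) \<Rightarrow> bool" where
  "greedy_basis smul qnorm e e' \<longleftrightarrow> (\<exists>c>0. \<exists>C>0. \<forall>x. \<forall>m\<ge>1.
    c * best_error smul qnorm e m x \<le> greedy_error smul qnorm e e' m x \<and>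
    greedy_error smul qnorm e e' m x \<le> C * best_error smul qnorm e m x)"

definition weights :: "(nat \<Rightarrow> real) set" where
  "weights = {\<omega>. 0 < \<omega> 1 \<and> (\<forall>m n. 1 \<le> m \<longrightarrow> m \<le> n \<longrightarrow> \<omega> m \<le> \<omega> n) \<and>
    filterlim \<omega> at_top sequentially}"

definition doubling_weights :: "(nat \<Rightarrow> real) set" where
  "doubling_weights = {\<omega> \<in> weights. \<exists>\<theta>\<ge>1. \<forall>n\<ge>1. \<omega> (2 * n) \<le> \<theta> * \<omega> n}"

definition lower_dilation :: "(nat \<Rightarrow> real) \<Rightarrow> nat \<Rightarrow> real" where
  "lower_dilation \<omega> M = (INF k\<in>{1..}. \<omega> (M * k) / \<omega> k)"

text \<open>The index is extended real because it is infinite for some non-doubling weights.\<close>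

definition lower_dilation_index :: "(nat \<Rightarrow> real) \<Rightarrow> ereal" where
  "lower_dilation_index \<omega> =
    (SUP M\<in>{1<..}. ereal (ln (lower_dilation \<omega> M) / ln (real M)))"

text \<open>
  A class is represented by its \<open>[0, \<infinity>]\<close>-valued functional \<open>\<parallel>\<cdot>\<parallel>\<close>, with \<open>\<A>\<close> being the set where
  it is finite. \<open>E n x\<close> stands for the error in question (best or greedy). The library has no
  real powers on \<open>ennreal\<close>, so the root is taken separately for a finite and an infinite sum.
\<close>

definition weighted_lq_norm :: "ennreal \<Rightarrow> (nat \<Rightarrow> real) \<Rightarrow> (nat \<Rightarrow> real) \<Rightarrow> ennreal" where
  "weighted_lq_norm q \<omega> a =
    (if q = \<infinity> then (SUP n\<in>{1..}. ennreal (\<omega> n * a n))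
     else
       let r = enn2real q;
           S = (\<Sum>k. ennreal ((\<omega> (Suc k) * a (Suc k)) powr r * (1 / real (Suc k))))
       in if S = \<infinity> then \<infinity> else ennreal (enn2real S powr (1 / r)))"

definition error_class_norm ::
    "('v \<Rightarrow> real) \<Rightarrow> (nat \<Rightarrow> 'v \<Rightarrow> real) \<Rightarrow> ennreal \<Rightarrow> (nat \<Rightarrow> real) \<Rightarrow> 'v \<Rightarrow> ennreal" where
  "error_class_norm qnorm E q \<omega> x = ennreal (qnorm x) + weighted_lq_norm q \<omega> (\<lambda>n. E n x)"

definition approximation_class_norm ::
    "('k \<Rightarrow> 'v::ab_group_add \<Rightarrow> 'v) \<Rightarrow> ('v \<Rightarrow> real) \<Rightarrow> (nat \<Rightarrow> 'v) \<Rightarrow>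
      ennreal \<Rightarrow> (nat \<Rightarrow> real) \<Rightarrow> 'v \<Rightarrow> ennreal" where
  "approximation_class_norm smul qnorm e = error_class_norm qnorm (best_error smul qnorm e)"

definition greedy_class_norm ::
    "('k::real_normed_field \<Rightarrow> 'v::ab_group_add \<Rightarrow> 'v) \<Rightarrow> ('v \<Rightarrow> real) \<Rightarrow> (nat \<Rightarrow> 'v) \<Rightarrow>
      (nat \<Rightarrow> 'v \<Rightarrow> 'k) \<Rightarrow> ennreal \<Rightarrow> (nat \<Rightarrow> real) \<Rightarrow> 'v \<Rightarrow> ennreal" where
  "greedy_class_norm smul qnorm e e' = error_class_norm qnorm (greedy_error smul qnorm e e')"

definition finiteness_class :: "('v \<Rightarrow> ennreal) \<Rightarrow> 'v set" where
  "finiteness_class F = {x. F x < \<infinity>}"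

definition class_embeds :: "('v \<Rightarrow> ennreal) \<Rightarrow> ('v \<Rightarrow> ennreal) \<Rightarrow> bool" where
  "class_embeds F G \<longleftrightarrow> finiteness_class F \<subseteq> finiteness_class G \<and>
    (\<exists>C>0. \<forall>x\<in>finiteness_class F. G x \<le> ennreal C * F x)"

definition class_equivalent :: "('v \<Rightarrow> ennreal) \<Rightarrow> ('v \<Rightarrow> ennreal) \<Rightarrow> bool" where
  "class_equivalent F G \<longleftrightarrow> class_embeds F G \<and> class_embeds G F"

end

theory Submission
  imports Defs
begin

section \<open>Weighted sequence norms\<close>

text \<open>The best error never exceeds the greedy error, and for a greedy basis the two agree up
  to a constant at every step. The weighted norms are monotone and homogeneous in the error sequence
  (\<open>weighted_lq_norm_mono_cmult\<close>), which gives part (1).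

  For part (2), the embedding of the approximation class into the greedy class is tested on
  \<open>indic A + indic B\<close> with \<open>A\<close>, \<open>B\<close> disjoint and
  \<open>card A = M * card B\<close>. All nonzero coefficients are equal, so a greedy algorithm may
  consume \<open>A\<close> first and keeps an error of the order of ||1_B|| for N = |A| steps. Best
  approximation can remove \<open>B\<close> first: after k = |B| steps the error is at most ||1_A||,
  and it vanishes after 2N steps. If V(n) is the size of the weighted norm of the indicator of {1,
  ..., n}, then up to constants ||1_B|| V(N) is at most (||1_A|| + ||1_B||) V(k) + ||1_A|| V(2N).
  Doubling compares V(2N) with V(N), and a positive dilation index makes V(k) as small a fraction of
  V(N) as desired once M is large (\<open>weights_growth\<close>, \<open>weight_sum_growth\<close>).
  The term with ||1_B|| on the right is absorbed, and ||1_B|| is bounded by a multiple of ||1_A||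
  (\<open>embedding_imp_sparse_democratic\<close>). Cutting \<open>B\<close> into boundedly many
  pieces reduces M to 1 (\<open>sparse_democratic_imp_democratic\<close>).

  Finally, democracy and unconditionality make the basis greedy
  (\<open>democratic_imp_greedy\<close>): the coefficients that a greedy set misses are exchanged
  for those it took instead. This needs bounded multipliers to act boundedly, which in the absence
  of convexity is the content of \<open>multiplier_bound\<close>.\<close>

lemma weights_pos:
  assumes "\<omega> \<in> weights" "1 \<le> n"
  shows "0 < \<omega> n"
  using assms unfolding weights_def by (auto intro: less_le_trans)

lemma weights_mono:
  assumes "\<omega> \<in> weights" "1 \<le> m" "m \<le> n"
  shows "\<omega> m \<le> \<omega> n"
  using assms unfolding weights_def by auto

lemma weighted_lq_norm_top [simp]:
  "weighted_lq_norm \<infinity> \<omega> a = (SUP n\<in>{1..}. ennreal (\<omega> n * a n))"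
  by (simp add: weighted_lq_norm_def)

text \<open>Estimates are made on the \<open>ennreal\<close> series, before the root is taken; this
  lemma and the next transfer them through the root and its separate infinite case.\<close>

lemma weighted_lq_norm_le_root:
  assumes "0 < r" "0 \<le> s"
    and "(\<Sum>k. ennreal ((\<omega> (Suc k) * a (Suc k)) powr r * (1 / real (Suc k)))) \<le> ennreal s"
  shows "weighted_lq_norm (ennreal r) \<omega> a \<le> ennreal (s powr (1 / r))"
proof -
  define S where "S = (\<Sum>k. ennreal ((\<omega> (Suc k) * a (Suc k)) powr r * (1 / real (Suc k))))"
  have le: "S \<le> ennreal s" using assms(3) unfolding S_def .
  then have fin: "S \<noteq> \<infinity>" by (auto simp: top_unique)
  have "enn2real S \<le> s"
    using le \<open>0 \<le> s\<close> by (simp add: enn2real_leI)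
  then have "enn2real S powr (1 / r) \<le> s powr (1 / r)"
    using \<open>0 < r\<close> by (intro powr_mono2) auto
  then show ?thesis
    using fin \<open>0 < r\<close> unfolding weighted_lq_norm_def S_def Let_def
    by (auto simp: ennreal_leI)
qed

lemma root_le_weighted_lq_norm:
  assumes "0 < r" "0 \<le> s"
    and "ennreal s \<le> (\<Sum>k. ennreal ((\<omega> (Suc k) * a (Suc k)) powr r * (1 / real (Suc k))))"
  shows "ennreal (s powr (1 / r)) \<le> weighted_lq_norm (ennreal r) \<omega> a"
proof -
  define S where "S = (\<Sum>k. ennreal ((\<omega> (Suc k) * a (Suc k)) powr r * (1 / real (Suc k))))"
  have le: "ennreal s \<le> S" using assms(3) unfolding S_def .
  show ?thesis
  proof (cases "S = \<infinity>")
    case True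
    then show ?thesis
      using \<open>0 < r\<close> unfolding weighted_lq_norm_def S_def Let_def by auto
  next
    case False
    then have "s \<le> enn2real S"
      using le \<open>0 \<le> s\<close> by (cases S) auto
    then have "s powr (1 / r) \<le> enn2real S powr (1 / r)"
      using assms by (intro powr_mono2) auto
    then show ?thesis
      using False \<open>0 < r\<close> unfolding weighted_lq_norm_def S_def Let_def
      by (auto simp: ennreal_leI)
  qed
qed

lemma weighted_lq_norm_mono_cmult:
  assumes w: "\<omega> \<in> weights" and q: "0 < q" and C: "0 < C"
    and ab: "\<And>n. 1 \<le> n \<Longrightarrow> 0 \<le> a n \<and> a n \<le> C * b n"
  shows "weighted_lq_norm q \<omega> a \<le> ennreal C * weighted_lq_norm q \<omega> b"
proof (cases q)
  case top
  have "ennreal (\<omega> n * a n) \<le> ennreal C * (SUP n\<in>{1..}. ennreal (\<omega> n * b n))" if "1 \<le> n" for n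
  proof -
    have "\<omega> n * a n \<le> C * (\<omega> n * b n)"
      using ab[OF that] weights_pos[OF w that] by (simp add: mult.left_commute)
    then have "ennreal (\<omega> n * a n) \<le> ennreal C * ennreal (\<omega> n * b n)"
      using C by (simp add: ennreal_mult'[symmetric] ennreal_leI)
    also have "\<dots> \<le> ennreal C * (SUP n\<in>{1..}. ennreal (\<omega> n * b n))"
      using that by (intro mult_left_mono SUP_upper) auto
    finally show ?thesis .
  qed
  then show ?thesis
    unfolding top weighted_lq_norm_top[unfolded infinity_ennreal_def]
    by (intro SUP_least) auto
next
  case (real r)
  then have r: "0 < r" using q by auto
  define S where "S = (\<lambda>a. \<Sum>k. ennreal ((\<omega> (Suc k) * a (Suc k)) powr r * (1 / real (Suc k))))"
  have S: "S a \<le> ennreal (C powr r) * S b"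
    unfolding S_def ennreal_suminf_cmult[symmetric]
  proof (intro suminf_le summableI)
    fix k
    have p: "0 \<le> \<omega> (Suc k)" using weights_pos[OF w, of "Suc k"] by simp
    have ab': "0 \<le> a (Suc k)" "a (Suc k) \<le> C * b (Suc k)" using ab[of "Suc k"] by auto
    then have b: "0 \<le> b (Suc k)" using C by (meson order_trans zero_le_mult_iff less_le_not_le)
    have "\<omega> (Suc k) * a (Suc k) \<le> C * (\<omega> (Suc k) * b (Suc k))"
      using mult_left_mono[OF ab'(2) p] by (simp only: mult.left_commute[of C])
    then have "(\<omega> (Suc k) * a (Suc k)) powr r \<le> (C * (\<omega> (Suc k) * b (Suc k))) powr r"
      using r ab' p by (intro powr_mono2) auto
    also have "\<dots> = C powr r * (\<omega> (Suc k) * b (Suc k)) powr r"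
      using C p b by (simp add: powr_mult)
    finally show "ennreal ((\<omega> (Suc k) * a (Suc k)) powr r * (1 / real (Suc k)))
        \<le> ennreal (C powr r) * ennreal ((\<omega> (Suc k) * b (Suc k)) powr r * (1 / real (Suc k)))"
      by (subst ennreal_mult'[symmetric]) (auto intro!: ennreal_leI simp: divide_right_mono)
  qed
  show ?thesis
  proof (cases "S b = \<infinity>")
    case True
    then have "weighted_lq_norm q \<omega> b = \<infinity>"
      unfolding real weighted_lq_norm_def S_def Let_def using r by simp
    then show ?thesis using C by (simp add: ennreal_mult_top)
  next
    case False
    then obtain s where s: "0 \<le> s" "S b = ennreal s" by (cases "S b") auto
    have "weighted_lq_norm q \<omega> a \<le> ennreal ((C powr r * s) powr (1 / r))"
      unfolding real using S s C
      by (intro weighted_lq_norm_le_root r) (auto simp: S_def ennreal_mult')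
    also have "(C powr r * s) powr (1 / r) = C * s powr (1 / r)"
      using C s r by (simp add: powr_mult powr_powr)
    also have "ennreal \<dots> = ennreal C * ennreal (s powr (1 / r))"
      using C by (simp add: ennreal_mult')
    also have "\<dots> \<le> ennreal C * weighted_lq_norm q \<omega> b"
      unfolding real using s
      by (intro mult_left_mono root_le_weighted_lq_norm r) (auto simp: S_def)
    finally show ?thesis .
  qed
qed

lemma error_class_embeds:
  assumes w: "\<omega> \<in> weights" and q: "0 < q" and C: "0 < C"
    and E: "\<And>n x. 1 \<le> n \<Longrightarrow> 0 \<le> E n x \<and> E n x \<le> C * F n x"
  shows "class_embeds (error_class_norm qnorm F q \<omega>) (error_class_norm qnorm E q \<omega>)"
proof -
  \<comment> \<open>The constant has to be at least 1 because both class norms share the summand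
    \<open>qnorm x\<close>.\<close>
  define D where "D = max 1 C"
  have D: "1 \<le> D" "C \<le> D" by (auto simp: D_def)
  have le: "error_class_norm qnorm E q \<omega> x \<le> ennreal D * error_class_norm qnorm F q \<omega> x" for x
  proof -
    have "weighted_lq_norm q \<omega> (\<lambda>n. E n x) \<le> ennreal C * weighted_lq_norm q \<omega> (\<lambda>n. F n x)"
      using E by (intro weighted_lq_norm_mono_cmult w q C) auto
    also have "\<dots> \<le> ennreal D * weighted_lq_norm q \<omega> (\<lambda>n. F n x)"
      using D by (intro mult_right_mono ennreal_leI) auto
    moreover have "ennreal (qnorm x) \<le> ennreal D * ennreal (qnorm x)"
      using D by (metis ennreal_1 ennreal_leI mult_1 mult_right_mono zero_le)
    ultimately show ?thesis
      unfolding error_class_norm_def distrib_left by (auto intro: add_mono)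
  qed
  have "error_class_norm qnorm E q \<omega> x < \<infinity>" if "error_class_norm qnorm F q \<omega> x < \<infinity>" for x
    using le[of x] that
    by (metis ennreal_mult_less_top ennreal_less_top infinity_ennreal_def le_less_trans)
  then show ?thesis
    unfolding class_embeds_def finiteness_class_def using le D by (auto intro!: exI[of _ D])
qed

section \<open>Growth of partial sums of weights\<close>

text \<open>A positive index supplies one \<open>M\<close> whose dilation factor exceeds 1;
  iterating it beats any given \<open>R\<close>.\<close>

lemma weights_growth:
  assumes w: "\<omega> \<in> weights" and i: "0 < lower_dilation_index \<omega>"
  shows "\<exists>M\<ge>1. \<forall>k\<ge>1. R * \<omega> k \<le> \<omega> (M * k)"
proof -
  obtain M where M: "1 < M" "0 < ln (lower_dilation \<omega> M) / ln (real M)"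
    using i unfolding lower_dilation_index_def less_SUP_iff by (auto simp: zero_ereal_def)
  define \<phi> where "\<phi> = lower_dilation \<omega> M"
  have ge1: "1 \<le> \<omega> (M * k) / \<omega> k" if "1 \<le> k" for k
    using weights_pos[OF w that] weights_mono[OF w that, of "M * k"] M by simp
  \<comment> \<open>Monotonicity of the weight gives \<open>1 \<le> \<phi>\<close>, and the positive
    logarithm then excludes equality.\<close>
  then have "1 \<le> \<phi>"
    unfolding \<phi>_def lower_dilation_def by (intro cINF_greatest) auto
  moreover have "\<phi> \<noteq> 1" using M unfolding \<phi>_def by auto
  ultimately have phi: "1 < \<phi>" by simp
  have step: "\<phi> * \<omega> k \<le> \<omega> (M * k)" if "1 \<le> k" for k
  proof -
    have "bdd_below ((\<lambda>k. \<omega> (M * k) / \<omega> k) ` {1..})"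
      using ge1 by (auto intro!: bdd_belowI2[of _ 1])
    then have "\<phi> \<le> \<omega> (M * k) / \<omega> k"
      unfolding \<phi>_def lower_dilation_def using that by (intro cINF_lower) auto
    then show ?thesis using weights_pos[OF w that] by (simp add: field_simps)
  qed
  have iter: "\<phi> ^ j * \<omega> k \<le> \<omega> (M ^ j * k)" if k: "1 \<le> k" for j k
  proof (induction j)
    case (Suc j)
    have "\<phi> * (\<phi> ^ j * \<omega> k) \<le> \<phi> * \<omega> (M ^ j * k)"
      using Suc phi by (intro mult_left_mono) auto
    also have "\<dots> \<le> \<omega> (M * (M ^ j * k))"
      using k M by (intro step) auto
    finally show ?case by (simp add: mult.assoc)
  qed simp
  obtain j where j: "R < \<phi> ^ j" using real_arch_pow[OF phi] by blast
  have "R * \<omega> k \<le> \<omega> (M ^ j * k)" if "1 \<le> k" for k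
    using iter[OF that, of j] j weights_pos[OF w that] mult_right_mono[of R "\<phi> ^ j" "\<omega> k"] by linarith
  then show ?thesis using M by (intro exI[of _ "M ^ j"]) auto
qed

text \<open>The two new terms of the longer sum, at positions 2N+1 and 2N+2, are each compared with
  the term at position N+1: doubling controls the numerators, and the denominators have only
  grown.\<close>

lemma weight_sum_doubling:
  fixes \<omega> :: "nat \<Rightarrow> real"
  assumes w: "\<omega> \<in> weights" and th: "\<forall>n\<ge>1. \<omega> (2 * n) \<le> \<theta> * \<omega> n" "1 \<le> \<theta>" and r: "0 < r"
  defines "u \<equiv> \<lambda>n. \<omega> (Suc n) powr r / real (Suc n)"
  shows "sum u {..<2 * N} \<le> 2 * \<theta> powr r * sum u {..<N}"
proof (induction N)
  case (Suc N)
  have d: "\<omega> (2 * Suc N) \<le> \<theta> * \<omega> (Suc N)" using th by auto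
  have "u i \<le> \<theta> powr r * u N" if i: "i = 2 * N \<or> i = Suc (2 * N)" for i
  proof -
    have p: "0 < \<omega> (Suc i)" "0 < \<omega> (Suc N)" using weights_pos[OF w] by auto
    have "\<omega> (Suc i) \<le> \<omega> (2 * Suc N)" using i by (intro weights_mono[OF w]) auto
    then have "\<omega> (Suc i) powr r \<le> (\<theta> * \<omega> (Suc N)) powr r"
      using d p r by (intro powr_mono2) auto
    then have "u i \<le> (\<theta> * \<omega> (Suc N)) powr r / real (Suc N)"
      unfolding u_def using i by (intro frac_le) auto
    then show ?thesis unfolding u_def using th p by (simp add: powr_mult)
  qed
  from this[of "2 * N"] this[of "Suc (2 * N)"] show ?case
    using Suc by (simp add: algebra_simps)
qed simp

text \<open>Each term at position m+1 is traded for the block of \<open>M\<close> terms that starts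
  at position M(m+1). Every term there has a much larger weight and a denominator at most 2M(m+1),
  so the whole block exceeds \<open>R\<close> times the original term.\<close>

lemma weight_sum_growth:
  fixes \<omega> :: "nat \<Rightarrow> real"
  assumes w: "\<omega> \<in> weights" and i: "0 < lower_dilation_index \<omega>" and r: "0 < r"
  defines "u \<equiv> \<lambda>n. \<omega> (Suc n) powr r / real (Suc n)"
  shows "\<exists>M\<ge>1. \<forall>k\<ge>1. R * sum u {..<k} \<le> sum u {..<M * k}"
proof -
  \<comment> \<open>The root is there because the sums contain \<open>r\<close>-th powers of the
    weight; the factor 2 pays for the denominators, which reach up to 2M(m+1) inside a
    block.\<close>
  define R' where "R' = (2 * max R 1) powr (1 / r)"
  have R': "0 < R'" "R' powr r \<ge> 2 * R"
    using r by (auto simp: R'_def powr_powr)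
  obtain M where M: "M \<ge> 1" "\<And>k. k \<ge> 1 \<Longrightarrow> R' * \<omega> k \<le> \<omega> (M * k)"
    using weights_growth[OF w i, of R'] by blast
  have unn: "0 \<le> u n" for n by (simp add: u_def)
  have "R * sum u {..<k} \<le> sum u {..<2 * M * k}" if k: "k \<ge> 1" for k
  proof -
    \<comment> \<open>The shift by \<open>M - 1\<close> makes the zero-based index \<open>i\<close>
      stand for position \<open>i + M\<close>, so block \<open>m\<close> covers the positions from
      M(m+1) on, and the blocks tile.\<close>
    have block: "R * u m \<le> (\<Sum>i\<in>{m * M..<m * M + M}. u (i + (M - 1)))" for m
    proof -
      have "R * u m / real M \<le> u (i + (M - 1))" if i: "i \<in> {m * M..<m * M + M}" for i
      proof -
        have n: "Suc (i + (M - 1)) = i + M" using M by simp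
        have ge: "M * Suc m \<le> i + M" and le: "i + M \<le> 2 * (M * Suc m)"
          using i by (auto simp: algebra_simps)
        have p: "0 < \<omega> (Suc m)" using weights_pos[OF w] by auto
        have "R' * \<omega> (Suc m) \<le> \<omega> (i + M)"
          using M(2)[of "Suc m"] weights_mono[OF w _ ge] M(1) by auto
        then have "(R' * \<omega> (Suc m)) powr r \<le> \<omega> (i + M) powr r"
          using R' p r by (intro powr_mono2) auto
        then have "R' powr r * \<omega> (Suc m) powr r \<le> \<omega> (i + M) powr r"
          using R' p by (simp add: powr_mult)
        moreover have "2 * R * \<omega> (Suc m) powr r \<le> R' powr r * \<omega> (Suc m) powr r"
          using R' by (intro mult_right_mono) auto
        ultimately have a: "2 * R * \<omega> (Suc m) powr r \<le> \<omega> (i + M) powr r" by linarith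
        have "real (i + M) \<le> 2 * (real M * real (Suc m))"
          using le by (metis of_nat_le_iff of_nat_mult of_nat_numeral)
        then have "\<omega> (i + M) powr r / (2 * (real M * real (Suc m))) \<le> \<omega> (i + M) powr r / real (i + M)"
          using M by (intro divide_left_mono) auto
        moreover have "2 * R * \<omega> (Suc m) powr r / (2 * (real M * real (Suc m)))
            \<le> \<omega> (i + M) powr r / (2 * (real M * real (Suc m)))"
          using a by (intro divide_right_mono) auto
        ultimately show ?thesis
          unfolding u_def n by (simp add: mult.commute)
      qed
      then have "(\<Sum>i\<in>{m * M..<m * M + M}. R * u m / real M)
          \<le> (\<Sum>i\<in>{m * M..<m * M + M}. u (i + (M - 1)))" by (rule sum_mono)
      then show ?thesis using M by simp
    qed
    have "R * sum u {..<k} \<le> (\<Sum>m<k. \<Sum>i\<in>{m * M..<m * M + M}. u (i + (M - 1)))"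
      unfolding sum_distrib_left by (intro sum_mono block)
    also have "\<dots> = (\<Sum>i<k * M. u (i + (M - 1)))"
      by (rule sum.nat_group)
    also have "\<dots> = sum u ((\<lambda>i. i + (M - 1)) ` {..<k * M})"
      by (subst sum.reindex) (auto simp: inj_on_def)
    also have "\<dots> \<le> sum u {..<2 * M * k}"
    proof (intro sum_mono2)
      have "M * 1 \<le> M * k" using k by (intro mult_le_mono2)
      then have "i + (M - 1) < 2 * M * k" if "i < k * M" for i
        using M(1) that mult.commute[of k M] by linarith
      then show "(\<lambda>i. i + (M - 1)) ` {..<k * M} \<subseteq> {..<2 * M * k}" by auto
    qed (auto simp: unn)
    finally show ?thesis .
  qed
  then show ?thesis using M by (intro exI[of _ "2 * M"]) auto
qed

section \<open>Weighted norms of step functions\<close>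

text \<open>\<open>V N\<close> is, up to constants, the weighted norm of the indicator of \<open>{1, \<dots>, N}\<close>; the extremal
  sequences used below are step functions, for which this is all that matters.\<close>

locale weighted_step_norm =
  fixes q :: ennreal and \<omega> V :: "nat \<Rightarrow> real" and \<Theta> Q :: real
  assumes V_mono: "1 \<le> m \<Longrightarrow> m \<le> n \<Longrightarrow> V m \<le> V n" and V1: "0 < V 1" and Q: "1 \<le> Q"
    and V_doubling: "1 \<le> N \<Longrightarrow> V (2 * N) \<le> \<Theta> * V N"
    and V_growth: "\<exists>M\<ge>1. \<forall>k\<ge>1. R * V k \<le> V (M * k)"
    and V_lower: "1 \<le> N \<Longrightarrow> 0 \<le> t \<Longrightarrow> (\<And>n. 1 \<le> n \<Longrightarrow> n \<le> N \<Longrightarrow> t \<le> a n)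
      \<Longrightarrow> ennreal (t * V N) \<le> weighted_lq_norm q \<omega> a"
    and V_upper: "1 \<le> k \<Longrightarrow> k \<le> N \<Longrightarrow> 0 \<le> s \<Longrightarrow> 0 \<le> t
      \<Longrightarrow> (\<And>n. 1 \<le> n \<Longrightarrow> 0 \<le> a n \<and> a n \<le> s)
      \<Longrightarrow> (\<And>n. k \<le> n \<Longrightarrow> a n \<le> t) \<Longrightarrow> (\<And>n. N \<le> n \<Longrightarrow> a n = 0)
      \<Longrightarrow> weighted_lq_norm q \<omega> a \<le> ennreal (Q * (s * V k + t * V N))"

text \<open>For infinite \<open>q\<close>, the weight itself serves as \<open>V\<close>, since a
  monotone weight attains its supremum over an initial segment at the end. For finite
  \<open>q = r\<close>, \<open>V N\<close> is the \<open>r\<close>-th root of the partial sum of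
  \<omega>(n)^r / n, whose doubling and growth are the two preceding lemmas.\<close>

lemma ex_weighted_step_norm:
  assumes w: "\<omega> \<in> doubling_weights" and i: "0 < lower_dilation_index \<omega>" and q: "0 < q"
  shows "\<exists>V \<Theta> Q. weighted_step_norm q \<omega> V \<Theta> Q"
proof -
  obtain \<theta> where th: "1 \<le> \<theta>" "\<forall>n\<ge>1. \<omega> (2 * n) \<le> \<theta> * \<omega> n" and W: "\<omega> \<in> weights"
    using w unfolding doubling_weights_def by blast
  note pos = weights_pos[OF W] and mono = weights_mono[OF W]
  show ?thesis
  proof (cases q)
    case top
    have "weighted_step_norm q \<omega> \<omega> \<theta> 1"
    proof (rule weighted_step_norm.intro)
      show "\<And>R. \<exists>M\<ge>1. \<forall>k\<ge>1. R * \<omega> k \<le> \<omega> (M * k)"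
        using weights_growth[OF W i] by blast
    next
      fix a :: "nat \<Rightarrow> real" and t N
      assume "1 \<le> N" "0 \<le> t" "\<And>n. 1 \<le> n \<Longrightarrow> n \<le> N \<Longrightarrow> t \<le> a n"
      then have "ennreal (t * \<omega> N) \<le> ennreal (\<omega> N * a N)"
        using pos[of N] by (intro ennreal_leI) (auto simp: mult.commute[of t])
      also have "\<dots> \<le> weighted_lq_norm q \<omega> a"
        unfolding top weighted_lq_norm_top[unfolded infinity_ennreal_def]
        using \<open>1 \<le> N\<close> by (intro SUP_upper) auto
      finally show "ennreal (t * \<omega> N) \<le> weighted_lq_norm q \<omega> a" .
    next
      fix a :: "nat \<Rightarrow> real" and s t k N
      assume k: "1 \<le> k" "k \<le> N" and st: "0 \<le> s" "0 \<le> t"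
        and a: "\<And>n. 1 \<le> n \<Longrightarrow> 0 \<le> a n \<and> a n \<le> s" "\<And>n. k \<le> n \<Longrightarrow> a n \<le> t" "\<And>n. N \<le> n \<Longrightarrow> a n = 0"
      have "\<omega> n * a n \<le> 1 * (s * \<omega> k + t * \<omega> N)" if n: "1 \<le> n" for n
      proof -
        have nn: "0 \<le> s * \<omega> k" "0 \<le> t * \<omega> N" using st pos[of k] pos[of N] k by auto
        consider "n < k" | "k \<le> n" "n < N" | "N \<le> n" by linarith
        then show ?thesis
        proof cases
          case 1
          then have "\<omega> n * a n \<le> \<omega> k * s"
            using mono[OF n, of k] a(1)[OF n] pos[OF n] by (intro mult_mono) auto
          then show ?thesis using nn by (simp add: mult.commute)
        next
          case 2
          then have "\<omega> n * a n \<le> \<omega> N * t"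
            using mono[OF n, of N] a(1)[OF n] a(2)[of n] pos[OF n] by (intro mult_mono) auto
          then show ?thesis using nn by (simp add: mult.commute)
        next
          case 3
          then show ?thesis using a(3) nn by simp
        qed
      qed
      then show "weighted_lq_norm q \<omega> a \<le> ennreal (1 * (s * \<omega> k + t * \<omega> N))"
        unfolding top weighted_lq_norm_top[unfolded infinity_ennreal_def]
        by (intro SUP_least ennreal_leI) auto
    qed (use th mono pos in auto)
    then show ?thesis by blast
  next
    case (real r)
    then have r: "0 < r" using q by auto
    define u where "u = (\<lambda>n. \<omega> (Suc n) powr r / real (Suc n))"
    define V where "V = (\<lambda>N. sum u {..<N} powr (1 / r))"
    have upos: "0 < u n" for n unfolding u_def using pos[of "Suc n"] by simp
    then have U0: "0 \<le> sum u A" for A by (intro sum_nonneg) (auto intro: less_imp_le)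
    have term_eq: "(\<omega> (Suc n) * c) powr r * (1 / real (Suc n)) = c powr r * u n" if "0 \<le> c" for n c
      unfolding u_def using that pos[of "Suc n"] by (simp add: powr_mult)
    have root: "(c powr r * sum u {..<N}) powr (1 / r) = c * V N" if "0 \<le> c" for c N
      unfolding V_def using that U0 r by (simp add: powr_mult powr_powr)
    have "weighted_step_norm q \<omega> V ((2 * \<theta> powr r) powr (1 / r)) (2 powr (1 / r))"
    proof (rule weighted_step_norm.intro)
      show "V m \<le> V n" if "m \<le> n" for m n
        unfolding V_def using U0 r that upos
        by (intro powr_mono2 sum_mono2) (auto intro: less_imp_le)
      show "0 < V 1" unfolding V_def using upos[of 0] by simp
      show "1 \<le> (2::real) powr (1 / r)" using r by (intro ge_one_powr_ge_zero) auto
    next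
      fix N
      have "sum u {..<2 * N} \<le> 2 * \<theta> powr r * sum u {..<N}"
        unfolding u_def using weight_sum_doubling[OF W th(2,1) r] .
      then have "V (2 * N) \<le> (2 * \<theta> powr r * sum u {..<N}) powr (1 / r)"
        unfolding V_def using U0 r by (intro powr_mono2) auto
      then show "V (2 * N) \<le> (2 * \<theta> powr r) powr (1 / r) * V N"
        unfolding V_def using U0 th by (simp add: powr_mult)
    next
      fix R :: real
      \<comment> \<open>Truncating \<open>R\<close> at 0 allows it to be moved inside the
        power.\<close>
      obtain M where M: "M \<ge> 1" "\<And>k. k \<ge> 1 \<Longrightarrow> (max R 0) powr r * sum u {..<k} \<le> sum u {..<M * k}"
        using weight_sum_growth[OF W i r] unfolding u_def by blast
      have "R * V k \<le> V (M * k)" if "k \<ge> 1" for k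
      proof -
        have "max R 0 * V k \<le> V (M * k)"
          unfolding root[of "max R 0", simplified, symmetric]
          unfolding V_def using M(2)[OF that] U0 r by (intro powr_mono2) auto
        moreover have "R * V k \<le> max R 0 * V k" unfolding V_def by (intro mult_right_mono) auto
        ultimately show ?thesis by linarith
      qed
      then show "\<exists>M\<ge>1. \<forall>k\<ge>1. R * V k \<le> V (M * k)" using M(1) by blast
    next
      fix a :: "nat \<Rightarrow> real" and t N
      assume t: "0 \<le> t" and a: "\<And>n. 1 \<le> n \<Longrightarrow> n \<le> N \<Longrightarrow> t \<le> a n"
      have "ennreal (t powr r * sum u {..<N}) = (\<Sum>n<N. ennreal (t powr r * u n))"
        unfolding sum_distrib_left using upos[THEN less_imp_le]
        by (subst sum_ennreal) simp_all
      also have "\<dots> \<le> (\<Sum>n<N. ennreal ((\<omega> (Suc n) * a (Suc n)) powr r * (1 / real (Suc n))))"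
      proof (intro sum_mono ennreal_leI)
        fix n assume "n \<in> {..<N}"
        then have "t \<le> a (Suc n)" using a by auto
        then have "t powr r * u n \<le> a (Suc n) powr r * u n"
          using t r upos[of n] by (intro mult_right_mono powr_mono2) auto
        then show "t powr r * u n \<le> (\<omega> (Suc n) * a (Suc n)) powr r * (1 / real (Suc n))"
          using \<open>t \<le> a (Suc n)\<close> t by (subst term_eq) auto
      qed
      also have "\<dots> \<le> (\<Sum>n. ennreal ((\<omega> (Suc n) * a (Suc n)) powr r * (1 / real (Suc n))))"
        by (intro sum_le_suminf) auto
      finally show "ennreal (t * V N) \<le> weighted_lq_norm q \<omega> a"
        unfolding root[OF t, symmetric] real using U0
        by (intro root_le_weighted_lq_norm r) auto
    next
      fix a :: "nat \<Rightarrow> real" and s t k N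
      assume k: "1 \<le> k" "k \<le> N" and st: "0 \<le> s" "0 \<le> t"
        and a: "\<And>n. 1 \<le> n \<Longrightarrow> 0 \<le> a n \<and> a n \<le> s" "\<And>n. k \<le> n \<Longrightarrow> a n \<le> t" "\<And>n. N \<le> n \<Longrightarrow> a n = 0"
      define \<alpha> where "\<alpha> = s powr r * sum u {..<k}"
      define \<beta> where "\<beta> = t powr r * sum u {..<N}"
      have ab: "0 \<le> \<alpha>" "0 \<le> \<beta>" unfolding \<alpha>_def \<beta>_def using U0 by auto
      have "(\<Sum>n. ennreal ((\<omega> (Suc n) * a (Suc n)) powr r * (1 / real (Suc n))))
          = (\<Sum>n<N. ennreal ((\<omega> (Suc n) * a (Suc n)) powr r * (1 / real (Suc n))))"
        using a(3) by (intro suminf_finite) auto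
      also have "\<dots> = ennreal (\<Sum>n<N. (\<omega> (Suc n) * a (Suc n)) powr r * (1 / real (Suc n)))"
        by (intro sum_ennreal) auto
      also have "\<dots> \<le> ennreal (\<alpha> + \<beta>)"
      proof (intro ennreal_leI)
        have "(\<Sum>n<N. (\<omega> (Suc n) * a (Suc n)) powr r * (1 / real (Suc n)))
            \<le> (\<Sum>n<N. (if n < k then s powr r * u n else 0) + t powr r * u n)"
        proof (intro sum_mono)
          fix n
          have an: "0 \<le> a (Suc n)" "a (Suc n) \<le> s" using a(1)[of "Suc n"] by auto
          have "a (Suc n) powr r \<le> s powr r" using an r by (intro powr_mono2) auto
          moreover have "a (Suc n) powr r \<le> t powr r" if "\<not> n < k"
            using an r a(2)[of "Suc n"] that by (intro powr_mono2) auto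
          ultimately have "a (Suc n) powr r \<le> (if n < k then s powr r else 0) + t powr r"
            by (auto intro: add_increasing2)
          then have "a (Suc n) powr r * u n \<le> ((if n < k then s powr r else 0) + t powr r) * u n"
            using upos[of n] by (intro mult_right_mono) auto
          then show "(\<omega> (Suc n) * a (Suc n)) powr r * (1 / real (Suc n))
              \<le> (if n < k then s powr r * u n else 0) + t powr r * u n"
            by (subst term_eq[OF an(1)]) (auto simp: algebra_simps split: if_splits)
        qed
        also have "\<dots> = (\<Sum>n<N. if n \<in> {..<k} then s powr r * u n else 0) + \<beta>"
          unfolding \<beta>_def sum.distrib sum_distrib_left by simp
        also have "(\<Sum>n<N. if n \<in> {..<k} then s powr r * u n else 0) = (\<Sum>n\<in>{..<N} \<inter> {..<k}. s powr r * u n)"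
          by (rule sum.inter_restrict[symmetric]) simp
        also have "{..<N} \<inter> {..<k} = {..<k}" using k by auto
        finally show "(\<Sum>n<N. (\<omega> (Suc n) * a (Suc n)) powr r * (1 / real (Suc n))) \<le> \<alpha> + \<beta>"
          unfolding \<alpha>_def sum_distrib_left .
      qed
      finally have "weighted_lq_norm q \<omega> a \<le> ennreal ((\<alpha> + \<beta>) powr (1 / r))"
        unfolding real using ab by (intro weighted_lq_norm_le_root r) auto
      \<comment> \<open>Passing through the maximum works for every \<open>r > 0\<close>, whether or
        not the \<open>r\<close>-th root is subadditive; it costs the factor
        \<open>2 powr (1 / r)\<close>.\<close>
      also have "(\<alpha> + \<beta>) powr (1 / r) \<le> (2 * max \<alpha> \<beta>) powr (1 / r)"
        using ab r by (intro powr_mono2) auto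
      also have "(2 * max \<alpha> \<beta>) powr (1 / r) = 2 powr (1 / r) * max \<alpha> \<beta> powr (1 / r)"
        using ab by (simp add: powr_mult)
      also have "max \<alpha> \<beta> powr (1 / r) \<le> \<alpha> powr (1 / r) + \<beta> powr (1 / r)"
        by (auto simp: max_def)
      also have "\<dots> = s * V k + t * V N"
        unfolding \<alpha>_def \<beta>_def using root st by auto
      finally show "weighted_lq_norm q \<omega> a \<le> ennreal (2 powr (1 / r) * (s * V k + t * V N))"
        by (simp add: ennreal_leI)
    qed
    then show ?thesis by blast
  qed
qed

section \<open>Greedy orderings\<close>

text \<open>These are the possible initial segments of greedy orderings, ties being broken
  arbitrarily. They replace orderings throughout the estimates.\<close>

definition greedy_set :: "(nat \<Rightarrow> 'v \<Rightarrow> 'k::real_normed_field) \<Rightarrow> 'v \<Rightarrow> nat set \<Rightarrow> bool" where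
  "greedy_set e' x \<Gamma> \<longleftrightarrow> finite \<Gamma> \<and> (\<forall>i\<in>\<Gamma>. \<forall>j. j \<notin> \<Gamma> \<longrightarrow> norm (e' j x) \<le> norm (e' i x))"

text \<open>Always choose a largest remaining value; it exists because only finitely many values
  exceed a positive level. A nonzero value cannot be passed over forever, since infinitely many
  chosen values would then be at least as large.\<close>

lemma decreasing_enumeration:
  fixes c :: "nat \<Rightarrow> real"
  assumes nonneg: "\<And>n. 0 \<le> c n" and fin: "\<And>\<epsilon>. 0 < \<epsilon> \<Longrightarrow> finite {n. \<epsilon> \<le> c n}"
  shows "\<exists>\<pi> :: nat \<Rightarrow> nat. inj \<pi> \<and> antimono (c \<circ> \<pi>) \<and> {n. c n \<noteq> 0} \<subseteq> range \<pi>"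
proof -
  have ex: "\<exists>k. k \<notin> S \<and> (\<forall>j. j \<notin> S \<longrightarrow> c j \<le> c k)" if S: "finite S" for S
  proof -
    obtain k0 where k0: "k0 \<notin> S" using ex_new_if_finite[OF infinite_UNIV_nat S] by blast
    show ?thesis
    proof (cases "\<exists>m. m \<notin> S \<and> 0 < c m")
      case True
      then obtain m where m: "m \<notin> S" "0 < c m" by blast
      define T where "T = {n. c m \<le> c n} - S"
      have T: "finite T" "m \<in> T" using fin[OF m(2)] m by (auto simp: T_def)
      then obtain k where k: "k \<in> T" "\<And>j. j \<in> T \<Longrightarrow> c j \<le> c k"
        using Max_in[of "c ` T"] Max_ge[of "c ` T"] by fastforce
      have "c j \<le> c k" if "j \<notin> S" for j
        using k T that by (cases "c m \<le> c j") (force simp: T_def)+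
      then show ?thesis using k by (auto simp: T_def)
    next
      case False
      then show ?thesis using k0 nonneg by (metis order_trans not_less)
    qed
  qed
  define f where "f = (\<lambda>S. SOME k. k \<notin> S \<and> (\<forall>j. j \<notin> S \<longrightarrow> c j \<le> c k))"
  have f: "f S \<notin> S" "\<And>j. j \<notin> S \<Longrightarrow> c j \<le> c (f S)" if "finite S" for S
    using someI_ex[OF ex[OF that]] unfolding f_def by auto
  \<comment> \<open>\<open>T n\<close> is the set of the first \<open>n\<close> choices.\<close>
  define T where "T = (\<lambda>n. ((\<lambda>S. insert (f S) S) ^^ n) {})"
  define \<pi> where "\<pi> = (\<lambda>n. f (T n))"
  have T: "T n = \<pi> ` {..<n}" for n
    by (induction n) (auto simp: T_def \<pi>_def lessThan_Suc)
  then have finT: "finite (T n)" for n by simp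
  have new: "\<pi> j \<notin> \<pi> ` {..<j}" for j
    using f(1)[OF finT, of j] T[of j] by (simp add: \<pi>_def)
  have inj: "inj \<pi>"
    by (rule linorder_injI) (metis new imageI lessThan_iff)
  have anti: "c j \<le> c (\<pi> i)" if "j \<notin> \<pi> ` {..<i}" for i j
    using f(2)[OF finT, of j i] that T[of i] by (simp add: \<pi>_def)
  have "c (\<pi> j) \<le> c (\<pi> i)" if "i \<le> j" for i j
    using that new[of j] by (intro anti) auto
  moreover have "n \<in> range \<pi>" if "c n \<noteq> 0" for n
  proof (rule ccontr)
    assume "n \<notin> range \<pi>"
    then have "c n \<le> c (\<pi> i)" for i by (intro anti) auto
    then have "range \<pi> \<subseteq> {m. c n \<le> c m}" by auto
    moreover have "finite {m. c n \<le> c m}" using nonneg[of n] that by (intro fin) auto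
    ultimately show False using inj finite_subset range_inj_infinite by blast
  qed
  ultimately show ?thesis
    using inj by (intro exI[of _ \<pi>]) (auto simp: monotone_def)
qed

lemma greedy_set_ordering:
  assumes fin: "\<And>\<epsilon>. 0 < \<epsilon> \<Longrightarrow> finite {n. \<epsilon> \<le> norm (e' n x)}" and \<Gamma>: "greedy_set e' x \<Gamma>"
  shows "\<exists>\<pi>. greedy_ordering e' x \<pi> \<and> \<pi> ` {..<card \<Gamma>} = \<Gamma>"
proof -
  have "finite \<Gamma>" using \<Gamma> by (simp add: greedy_set_def)
  define c where "c = (\<lambda>n. norm (e' n x))"
  \<comment> \<open>A strict upper bound for all coefficients: only finitely many of them reach 1,
    and 1 plus their sum will do.\<close>
  obtain b where b: "\<And>n. c n < b"
  proof -
    have "c n < 1 + (\<Sum>m\<in>{m. 1 \<le> c m}. c m)" for n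
    proof (cases "1 \<le> c n")
      case True
      then show ?thesis
        using member_le_sum[of n "{m. 1 \<le> c m}" c] fin[of 1] by (auto simp: c_def)
    next
      case False
      moreover have "0 \<le> (\<Sum>m\<in>{m. 1 \<le> c m}. c m)" by (intro sum_nonneg) auto
      ultimately show ?thesis by linarith
    qed
    then show thesis using that by blast
  qed
  have c0: "0 \<le> c n" for n by (simp add: c_def)
  then have b0: "0 < b" using b[of 0] by (meson le_less_trans)
  \<comment> \<open>Lifting the coefficients on \<open>\<Gamma>\<close> above all others breaks the ties in favour of \<open>\<Gamma>\<close>.\<close>
  define c' where "c' = (\<lambda>n. c n + (if n \<in> \<Gamma> then b else 0))"
  have fin': "finite {n. \<epsilon> \<le> c' n}" if "0 < \<epsilon>" for \<epsilon>
    by (rule finite_subset[of _ "{n. \<epsilon> \<le> c n} \<union> \<Gamma>"])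
      (use fin[OF that] \<open>finite \<Gamma>\<close> in \<open>auto simp: c'_def c_def\<close>)
  have "\<And>n. 0 \<le> c' n" using c0 b0 by (simp add: c'_def)
  from decreasing_enumeration[OF this fin']
  obtain \<pi> :: "nat \<Rightarrow> nat"
    where "inj \<pi> \<and> antimono (c' \<circ> \<pi>) \<and> {n. c' n \<noteq> 0} \<subseteq> range \<pi>" ..
  then have \<pi>: "inj \<pi>" "\<And>i j. i \<le> j \<Longrightarrow> c' (\<pi> j) \<le> c' (\<pi> i)" "{n. c' n \<noteq> 0} \<subseteq> range \<pi>"
    by (auto simp: monotone_def)
  have lt: "c' j < c' i" if "i \<in> \<Gamma>" "j \<notin> \<Gamma>" for i j
    using that b[of j] c0[of i] by (simp add: c'_def)
  \<comment> \<open>The lift never reverses an order of coefficients, because members of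
    \<open>\<Gamma>\<close> already dominate all the others.\<close>
  have imp: "c j \<le> c i" if "c' j \<le> c' i" for i j
    using that \<Gamma> lt[of j i] by (auto simp: c'_def c_def greedy_set_def split: if_splits)
  have "\<Gamma> \<subseteq> range \<pi>" "basis_support e' x \<subseteq> range \<pi>"
    using \<pi>(3) c0 b0
    by (auto simp: c'_def basis_support_def c_def add_nonneg_eq_0_iff subset_iff)
  have "greedy_ordering e' x \<pi>"
    unfolding greedy_ordering_def
    using \<pi>(1,2) imp \<open>basis_support e' x \<subseteq> range \<pi>\<close> by (auto simp: c_def)
  \<comment> \<open>The times at which \<open>\<Gamma>\<close> is visited form a finite, downward
    closed set, hence an initial segment of length \<open>card \<Gamma>\<close>.\<close>
  define I where "I = \<pi> -` \<Gamma>"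
  have "finite I" "\<pi> ` I = \<Gamma>"
    using \<open>\<Gamma> \<subseteq> range \<pi>\<close> \<open>finite \<Gamma>\<close> \<pi>(1) by (auto simp: I_def intro: finite_vimageI)
  moreover have "card I = card \<Gamma>"
    using \<pi>(1) \<open>\<pi> ` I = \<Gamma>\<close> by (metis card_image inj_on_subset subset_UNIV)
  moreover have "i \<in> I" if "j \<in> I" "i \<le> j" for i j
    using \<pi>(2)[OF that(2)] lt[of "\<pi> j" "\<pi> i"] that by (force simp: I_def)
  then have "I = {..<LEAST n. n \<notin> I}"
    using ex_new_if_finite[OF infinite_UNIV_nat \<open>finite I\<close>]
    by (metis (mono_tags, lifting) LeastI_ex lessThan_iff not_le_imp_less not_less_Least set_eqI)
  then have "I = {..<card I}" by (metis card_lessThan)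
  ultimately show ?thesis using \<open>greedy_ordering e' x \<pi>\<close> by metis
qed

lemma greedy_ordering_set:
  assumes "greedy_ordering e' x \<pi>"
  shows "greedy_set e' x (\<pi> ` {..<m})"
  unfolding greedy_set_def
proof (intro conjI ballI allI impI)
  fix i j assume i: "i \<in> \<pi> ` {..<m}" and j: "j \<notin> \<pi> ` {..<m}"
  then obtain k where k: "i = \<pi> k" "k < m" by auto
  show "norm (e' j x) \<le> norm (e' i x)"
  proof (cases "j \<in> range \<pi>")
    case True
    then obtain l where "j = \<pi> l" by auto
    moreover have "k \<le> l" using j k \<open>j = \<pi> l\<close> by (metis image_eqI le_trans lessThan_iff linorder_not_le less_imp_le)
    ultimately show ?thesis using assms k by (auto simp: greedy_ordering_def)
  next
    case False
    then have "e' j x = 0" using assms by (auto simp: greedy_ordering_def basis_support_def)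
    then show ?thesis by simp
  qed
qed simp

section \<open>Unconditional bases of quasi-Banach spaces\<close>

lemma (in quasi_banach_space) qnorm_zero [simp]: "qnorm 0 = 0"
  by (simp add: qnorm_eq_0_iff)

lemma (in quasi_banach_space) qnorm_scaled:
  assumes "x \<noteq> 0"
  shows "qnorm (smul (of_real (1 / qnorm x)) x) = 1"
  using assms qnorm_nonneg[of x] qnorm_eq_0_iff[of x]
  by (simp add: qnorm_smul norm_divide)

lemma (in quasi_banach_space) norm_functional_le:
  assumes f: "f \<in> dual_space smul qnorm" and C: "dual_norm qnorm f \<le> ennreal C" "0 \<le> C"
  shows "norm (f x) \<le> C * qnorm x"
proof (cases "x = 0")
  case False
  define y where "y = smul (of_real (1 / qnorm x)) x"
  have lin: "module_hom smul (*) f" using f by (simp add: dual_space_def module_hom_iff_linear)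
  have "ennreal (norm (f y)) \<le> dual_norm qnorm f"
    unfolding dual_norm_def using qnorm_scaled[OF False] by (intro SUP_upper) (auto simp: y_def)
  then have "ennreal (norm (f y)) \<le> ennreal C" using C(1) by (rule order_trans)
  then have "norm (f y) \<le> C" using C by simp
  moreover have "f y = of_real (1 / qnorm x) * f x"
    unfolding y_def using lin by (simp add: module_hom.scale)
  moreover have "0 < qnorm x" using False qnorm_nonneg[of x] qnorm_eq_0_iff[of x] by simp
  ultimately show ?thesis by (simp add: norm_mult norm_divide field_simps)
next
  case True
  have "module_hom smul (*) f" using f by (simp add: dual_space_def module_hom_iff_linear)
  then have "f 0 = 0" by (rule module_hom.zero)
  then show ?thesis using True by simp
qed

section \<open>Finite combinations and best errors for M-bases\<close>

context M_basis
begin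

lemma module_hom_functional: "module_hom smul (*) (e' n)"
  using functionals[of n] by (simp add: dual_space_def module_hom_iff_linear)

lemma functional_simps [simp]:
  "e' n (x + y) = e' n x + e' n y"
  "e' n (x - y) = e' n x - e' n y"
  "e' n (smul t x) = t * e' n x"
  "e' n 0 = 0"
  "e' n (sum f A) = (\<Sum>i\<in>A. e' n (f i))"
  using module_hom_functional[of n]
  by (simp_all add: module_hom.add module_hom.diff module_hom.scale module_hom.zero module_hom.sum)

definition lincomb :: "nat set \<Rightarrow> (nat \<Rightarrow> 'k) \<Rightarrow> 'v" where
  "lincomb F b = (\<Sum>n\<in>F. smul (b n) (e n))"

abbreviation indic :: "nat set \<Rightarrow> 'v" where
  "indic A \<equiv> lincomb A (\<lambda>_. 1)"

abbreviation proj :: "nat set \<Rightarrow> 'v \<Rightarrow> 'v" where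
  "proj \<equiv> basis_projection smul e e'"

lemma proj_eq_lincomb: "proj A x = lincomb A (\<lambda>n. e' n x)"
  by (simp add: basis_projection_def lincomb_def)

lemma lincomb_empty [simp]: "lincomb {} b = 0"
  by (simp add: lincomb_def)

lemma lincomb_cong: "(\<And>n. n \<in> F \<Longrightarrow> a n = b n) \<Longrightarrow> lincomb F a = lincomb F b"
  by (simp add: lincomb_def)

lemma smul_lincomb: "smul t (lincomb F b) = lincomb F (\<lambda>n. t * b n)"
  by (simp add: lincomb_def scale_sum_right)

lemma lincomb_add: "lincomb F a + lincomb F b = lincomb F (\<lambda>n. a n + b n)"
  by (simp add: lincomb_def scale_left_distrib sum.distrib)

lemma lincomb_Un:
  "finite A \<Longrightarrow> finite B \<Longrightarrow> A \<inter> B = {} \<Longrightarrow> lincomb (A \<union> B) b = lincomb A b + lincomb B b"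
  by (simp add: lincomb_def sum.union_disjoint)

lemma functional_lincomb [simp]:
  "finite F \<Longrightarrow> e' n (lincomb F b) = (if n \<in> F then b n else 0)"
  by (simp add: lincomb_def biorthogonal if_distrib cong: if_cong)

lemma proj_lincomb:
  assumes "finite F" "finite A"
  shows "proj A (lincomb F b) = lincomb (A \<inter> F) b"
  unfolding basis_projection_def lincomb_def[of "A \<inter> F"] sum.inter_restrict[OF assms(2)]
  using assms by (intro sum.cong) auto

lemma proj_diff: "proj A (x - y) = proj A x - proj A y"
  by (simp add: basis_projection_def scale_left_diff_distrib sum_subtractf)

text \<open>Democracy restricted to disjoint sets, where the dominating set may be \<open>M\<close>
  times larger; this is the form that the test vectors deliver. The case \<open>M = 1\<close>
  suffices for greediness.\<close>

definition sparse_democratic :: "nat \<Rightarrow> real \<Rightarrow> bool" where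
  "sparse_democratic M D \<longleftrightarrow> (\<forall>A B. finite A \<longrightarrow> finite B \<longrightarrow> 1 \<le> card B \<longrightarrow> card A = M * card B
    \<longrightarrow> A \<inter> B = {} \<longrightarrow> qnorm (indic B) \<le> D * qnorm (indic A))"

lemma best_error_set_nonempty:
  "\<exists>A. finite (A::nat set) \<and> card A = m"
  by (intro exI[of _ "{..<m}"]) simp

lemma best_error_nonneg: "0 \<le> best_error smul qnorm e m x"
  unfolding best_error_def using best_error_set_nonempty[of m] qnorm_nonneg
  by (intro cInf_greatest) auto

text \<open>The best error is defined with sets of exactly \<open>m\<close> elements; smaller sets
  are padded with zero coefficients.\<close>

lemma best_error_le:
  assumes "finite A" "card A \<le> m"
  shows "best_error smul qnorm e m x \<le> qnorm (x - lincomb A b)"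
proof -
  obtain B where B: "finite B" "card B = m" "A \<subseteq> B"
  proof -
    obtain B' where "finite B'" "card B' = m - card A" "A \<inter> B' = {}"
      using finite_arbitrarily_large_disj[OF infinite_UNIV_nat assms(1)] by blast
    then show thesis using assms that[of "A \<union> B'"] by (simp add: card_Un_disjoint)
  qed
  define b' where "b' = (\<lambda>n. if n \<in> A then b n else 0)"
  have "lincomb B b' = lincomb A b"
    unfolding lincomb_def using B by (intro sum.mono_neutral_cong_right) (auto simp: b'_def)
  moreover have "best_error smul qnorm e m x \<le> qnorm (x - lincomb B b')"
    unfolding best_error_def using qnorm_nonneg B
    by (intro cInf_lower) (auto simp: lincomb_def intro!: bdd_belowI[of _ 0])
  ultimately show ?thesis by simp
qed

end

section \<open>Unconditional bases with fixed constants\<close>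

locale unconditional_M_basis = M_basis smul qnorm e e'
  for smul :: "'k::{real_normed_field, heine_borel} \<Rightarrow> 'v::ab_group_add \<Rightarrow> 'v"
    and qnorm e e' +
  fixes \<kappa> K c C :: real
  assumes \<kappa>: "1 \<le> \<kappa>" "\<And>x y. qnorm (x + y) \<le> \<kappa> * (qnorm x + qnorm y)"
    and K: "1 \<le> K" "\<And>A x. finite A \<Longrightarrow> qnorm (basis_projection smul e e' A x) \<le> K * qnorm x"
    and c: "0 < c" "\<And>n. c \<le> qnorm (e n)"
    and C: "0 < C" "\<And>n. qnorm (e n) \<le> C" "\<And>n x. norm (e' n x) \<le> C * qnorm x"
begin

lemma qnorm_diff: "qnorm (x - y) \<le> \<kappa> * (qnorm x + qnorm y)"
proof -
  have "qnorm (x - y) \<le> \<kappa> * (qnorm x + qnorm (smul (- 1) y))"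
    using \<kappa>(2)[of x "smul (- 1) y"] by simp
  then show ?thesis unfolding qnorm_smul by simp
qed

text \<open>The crude factor is harmless: it is used where the number of summands is fixed in
  advance, or where mere finiteness is at stake.\<close>

lemma qnorm_sum:
  assumes "finite I"
  shows "qnorm (\<Sum>i\<in>I. f i) \<le> \<kappa> ^ card I * (\<Sum>i\<in>I. qnorm (f i))"
  using assms
proof (induction I)
  case empty
  then show ?case by simp
next
  case (insert i I)
  have "1 \<le> \<kappa> ^ card I" using \<kappa>(1) by (rule one_le_power)
  then have "qnorm (f i) \<le> \<kappa> ^ card I * qnorm (f i)"
    using mult_right_mono[of 1 "\<kappa> ^ card I" "qnorm (f i)"] qnorm_nonneg by simp
  then have "qnorm (f i) + qnorm (sum f I) \<le> \<kappa> ^ card I * (qnorm (f i) + (\<Sum>i\<in>I. qnorm (f i)))"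
    using insert.IH by (simp add: distrib_left)
  then have "\<kappa> * (qnorm (f i) + qnorm (sum f I))
      \<le> \<kappa> * (\<kappa> ^ card I * (qnorm (f i) + (\<Sum>i\<in>I. qnorm (f i))))"
    using \<kappa>(1) by (intro mult_left_mono) auto
  then show ?case using insert.hyps \<kappa>(2)[of "f i" "sum f I"] by (simp add: mult.assoc)
qed

lemma qnorm_lincomb_subset:
  assumes "finite F" "A \<subseteq> F"
  shows "qnorm (lincomb A b) \<le> K * qnorm (lincomb F b)"
  using K(2)[of A "lincomb F b"] assms proj_lincomb[of F A b]
  by (simp add: finite_subset Int_absorb2)

text \<open>A vector of the span within \<open>\<epsilon> / C\<close> of \<open>x\<close> has finite
  support, and off that support the coefficients of \<open>x\<close> are smaller than
  \<open>\<epsilon>\<close>.\<close>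

lemma finite_large_coefficients:
  assumes "0 < \<epsilon>"
  shows "finite {n. \<epsilon> \<le> norm (e' n x)}"
proof -
  have "0 < \<epsilon> / C" using assms C(1) by simp
  then obtain y where y: "y \<in> span (range e)" "qnorm (x - y) < \<epsilon> / C"
    using dense_span by blast
  have "finite {n. e' n y \<noteq> 0}"
    using y(1)
  proof (induction rule: span_induct_alt)
    case base
    then show ?case by simp
  next
    case (step t v z)
    then obtain i where "v = e i" by auto
    then have "{n. e' n (smul t v + z) \<noteq> 0} \<subseteq> insert i {n. e' n z \<noteq> 0}"
      by (auto simp: biorthogonal)
    then show ?case using step by (meson finite_insert finite_subset)
  qed
  moreover have "{n. \<epsilon> \<le> norm (e' n x)} \<subseteq> {n. e' n y \<noteq> 0}"
  proof (rule subsetI, rule ccontr)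
    fix n assume n: "n \<in> {n. \<epsilon> \<le> norm (e' n x)}" "n \<notin> {n. e' n y \<noteq> 0}"
    then have "norm (e' n x) = norm (e' n (x - y))" by simp
    also have "\<dots> \<le> C * qnorm (x - y)" by (rule C(3))
    also have "\<dots> < \<epsilon>" using y(2) C(1) by (simp add: field_simps)
    finally show False using n by simp
  qed
  ultimately show ?thesis by (rule rev_finite_subset)
qed

lemma ex_greedy_set: "\<exists>\<Gamma>. greedy_set e' x \<Gamma> \<and> card \<Gamma> = m"
proof -
  have "greedy_set e' x {}" by (simp add: greedy_set_def)
  then obtain \<pi> where \<pi>: "greedy_ordering e' x \<pi>"
    using greedy_set_ordering[of e' x "{}", OF finite_large_coefficients] by blast
  then have "card (\<pi> ` {..<m}) = m"
    by (subst card_image) (auto simp: greedy_ordering_def intro: inj_on_subset)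
  then show ?thesis using greedy_ordering_set[OF \<pi>] by blast
qed

lemma greedy_error_eq_SUP:
  "greedy_error smul qnorm e e' m x
    = (SUP \<Gamma>\<in>{\<Gamma>. greedy_set e' x \<Gamma> \<and> card \<Gamma> = m}. qnorm (x - proj \<Gamma> x))"
proof -
  have "(\<Sum>i<m. smul (e' (\<pi> i) x) (e (\<pi> i))) = proj (\<pi> ` {..<m}) x"
    if "greedy_ordering e' x \<pi>" for \<pi>
    unfolding basis_projection_def using that
    by (subst sum.reindex) (auto simp: greedy_ordering_def intro: inj_on_subset)
  then have "(\<lambda>\<pi>. qnorm (x - (\<Sum>i<m. smul (e' (\<pi> i) x) (e (\<pi> i))))) ` {\<pi>. greedy_ordering e' x \<pi>}
      = (\<lambda>\<Gamma>. qnorm (x - proj \<Gamma> x)) ` (\<lambda>\<pi>. \<pi> ` {..<m}) ` {\<pi>. greedy_ordering e' x \<pi>}"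
    unfolding image_image by (intro image_cong) auto
  moreover have "(\<lambda>\<pi>. \<pi> ` {..<m}) ` {\<pi>. greedy_ordering e' x \<pi>} = {\<Gamma>. greedy_set e' x \<Gamma> \<and> card \<Gamma> = m}"
  proof (intro equalityI subsetI)
    fix \<Gamma> assume "\<Gamma> \<in> (\<lambda>\<pi>. \<pi> ` {..<m}) ` {\<pi>. greedy_ordering e' x \<pi>}"
    then obtain \<pi> where "greedy_ordering e' x \<pi>" "\<Gamma> = \<pi> ` {..<m}" by auto
    then show "\<Gamma> \<in> {\<Gamma>. greedy_set e' x \<Gamma> \<and> card \<Gamma> = m}"
      using greedy_ordering_set[of e' x \<pi> m] card_image[of \<pi> "{..<m}"]
      by (auto simp: greedy_ordering_def intro: inj_on_subset)
  next
    fix \<Gamma> assume "\<Gamma> \<in> {\<Gamma>. greedy_set e' x \<Gamma> \<and> card \<Gamma> = m}"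
    then obtain \<pi> where "greedy_ordering e' x \<pi>" "\<pi> ` {..<m} = \<Gamma>"
      using greedy_set_ordering[of e' x \<Gamma>, OF finite_large_coefficients] by auto
    then show "\<Gamma> \<in> (\<lambda>\<pi>. \<pi> ` {..<m}) ` {\<pi>. greedy_ordering e' x \<pi>}" by auto
  qed
  ultimately show ?thesis unfolding greedy_error_def by simp
qed

lemma qnorm_proj_compl:
  assumes "finite A"
  shows "qnorm (x - proj A x) \<le> \<kappa> * (1 + K) * qnorm x"
proof -
  have "\<kappa> * (qnorm x + qnorm (proj A x)) \<le> \<kappa> * (qnorm x + K * qnorm x)"
    using \<kappa>(1) K(2)[OF assms] by (intro mult_left_mono add_left_mono) auto
  then show ?thesis using qnorm_diff[of x "proj A x"] by (simp add: algebra_simps)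
qed

lemma greedy_error_ge:
  assumes "greedy_set e' x \<Gamma>"
  shows "qnorm (x - proj \<Gamma> x) \<le> greedy_error smul qnorm e e' (card \<Gamma>) x"
  unfolding greedy_error_eq_SUP
proof (rule cSUP_upper)
  \<comment> \<open>Unconditionality bounds all residuals at once, so the real supremum dominates
    each of them.\<close>
  show "bdd_above ((\<lambda>\<Gamma>. qnorm (x - proj \<Gamma> x)) ` {\<Gamma>'. greedy_set e' x \<Gamma>' \<and> card \<Gamma>' = card \<Gamma>})"
    by (intro bdd_aboveI2[where M = "\<kappa> * (1 + K) * qnorm x"] qnorm_proj_compl)
      (auto simp: greedy_set_def)
qed (simp add: assms)

lemma best_error_le_greedy_error:
  "best_error smul qnorm e m x \<le> greedy_error smul qnorm e e' m x"
proof -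
  obtain \<Gamma> where \<Gamma>: "greedy_set e' x \<Gamma>" "card \<Gamma> = m" using ex_greedy_set by blast
  then have "best_error smul qnorm e m x \<le> qnorm (x - proj \<Gamma> x)"
    unfolding proj_eq_lincomb by (intro best_error_le) (auto simp: greedy_set_def)
  then show ?thesis using greedy_error_ge[OF \<Gamma>(1)] \<Gamma>(2) by simp
qed

section \<open>Bounded multipliers\<close>

text \<open>Without local convexity, multipliers cannot be averaged over projections. Instead, a
  multiplier with values in the unit ball is \<open>1/(2\<kappa>)\<close>-close to one with values in a fixed finite
  set, and the error is absorbed into the supremum over all multipliers.\<close>

lemma multiplier_bound:
  obtains L where "1 \<le> L"
    "\<And>F a b. finite F \<Longrightarrow> (\<And>n. n \<in> F \<Longrightarrow> norm (a n) \<le> 1)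
      \<Longrightarrow> qnorm (lincomb F (\<lambda>n. a n * b n)) \<le> L * qnorm (lincomb F b)"
proof -
  define \<epsilon> where "\<epsilon> = 1 / (2 * \<kappa>)"
  have \<epsilon>: "0 < \<epsilon>" using \<kappa>(1) by (simp add: \<epsilon>_def)
  have "seq_compact (cball (0::'k) 1)" by (intro compact_imp_seq_compact compact_cball)
  from seq_compact_imp_totally_bounded[OF this, rule_format, OF \<epsilon>]
  obtain D where D: "finite D" "D \<subseteq> cball (0::'k) 1" "cball 0 1 \<subseteq> (\<Union>d\<in>D. ball d \<epsilon>)"
    by blast
  have "\<forall>z\<in>cball 0 1. \<exists>d\<in>D. dist d z < \<epsilon>" using D(3) by (auto simp: subset_iff)
  then obtain d where d: "\<And>z. norm z \<le> 1 \<Longrightarrow> d z \<in> D \<and> dist (d z) z < \<epsilon>"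
    by (metis mem_cball_0)
  define L0 where "L0 = \<kappa> ^ card D * (real (card D) * K)"
  have discrete: "qnorm (lincomb F (\<lambda>n. d (a n) * b n)) \<le> L0 * qnorm (lincomb F b)"
    if F: "finite F" and a: "\<And>n. n \<in> F \<Longrightarrow> norm (a n) \<le> 1" for F a b
  proof -
    have "(\<Sum>s\<in>D. smul s (lincomb {n \<in> F. d (a n) = s} b))
        = (\<Sum>s\<in>D. \<Sum>n\<in>{n \<in> F. d (a n) = s}. smul (d (a n) * b n) (e n))"
      unfolding lincomb_def scale_sum_right by (intro sum.cong) auto
    also have "\<dots> = lincomb F (\<lambda>n. d (a n) * b n)"
      unfolding lincomb_def using F D(1) a d by (intro sum.group) auto
    finally have "qnorm (lincomb F (\<lambda>n. d (a n) * b n))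
        = qnorm (\<Sum>s\<in>D. smul s (lincomb {n \<in> F. d (a n) = s} b))" by simp
    also have "\<dots> \<le> \<kappa> ^ card D * (\<Sum>s\<in>D. qnorm (smul s (lincomb {n \<in> F. d (a n) = s} b)))"
      by (rule qnorm_sum[OF D(1)])
    also have "(\<Sum>s\<in>D. qnorm (smul s (lincomb {n \<in> F. d (a n) = s} b)))
        \<le> (\<Sum>s\<in>D. 1 * (K * qnorm (lincomb F b)))"
      unfolding qnorm_smul using F D(2) qnorm_nonneg
      by (intro sum_mono mult_mono qnorm_lincomb_subset) auto
    finally show ?thesis using \<kappa>(1) by (simp add: L0_def mult.assoc mult_left_mono)
  qed
  define L where "L = max 1 (2 * \<kappa> * L0)"
  have "qnorm (lincomb F (\<lambda>n. a n * b n)) \<le> L * qnorm (lincomb F b)"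
    if F: "finite F" and a: "\<And>n. n \<in> F \<Longrightarrow> norm (a n) \<le> 1" for F a b
  proof -
    define Q where "Q = {a. \<forall>n\<in>F. norm (a n :: 'k) \<le> 1}"
    define f where "f = (\<lambda>a. qnorm (lincomb F (\<lambda>n. a n * b n)))"
    define S where "S = (SUP a\<in>Q. f a)"
    \<comment> \<open>Absorbing \<open>S / 2\<close> below requires a finite supremum; a bound
      depending on \<open>F\<close> is enough for that.\<close>
    have bdd: "bdd_above (f ` Q)"
    proof (rule bdd_aboveI2)
      fix a assume a: "a \<in> Q"
      have "f a \<le> \<kappa> ^ card F * (\<Sum>n\<in>F. qnorm (smul (a n * b n) (e n)))"
        unfolding f_def lincomb_def by (rule qnorm_sum[OF F])
      also have "\<dots> \<le> \<kappa> ^ card F * (\<Sum>n\<in>F. 1 * qnorm (smul (b n) (e n)))"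
        unfolding qnorm_smul norm_mult mult.assoc using \<kappa>(1) a qnorm_nonneg
        by (intro mult_left_mono sum_mono mult_right_mono) (auto simp: Q_def)
      finally show "f a \<le> \<kappa> ^ card F * (\<Sum>n\<in>F. 1 * qnorm (smul (b n) (e n)))" .
    qed
    have upper: "f a \<le> S" if "a \<in> Q" for a
      unfolding S_def using bdd that by (rule cSUP_upper[rotated])
    have "f a \<le> \<kappa> * L0 * qnorm (lincomb F b) + S / 2" if a: "a \<in> Q" for a
    proof -
      \<comment> \<open>The rescaled rounding error is again an admissible multiplier, so its
        contribution is at most \<open>\<kappa> * \<epsilon> * S\<close>, which is half of
        \<open>S\<close>.\<close>
      define a' where "a' = (\<lambda>n. (a n - d (a n)) / of_real \<epsilon>)"
      have "norm (a n - d (a n)) \<le> \<epsilon>" if "n \<in> F" for n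
        using d[of "a n"] a that by (force simp: Q_def dist_norm norm_minus_commute)
      then have "a' \<in> Q" using \<epsilon> by (simp add: Q_def a'_def norm_divide)
      have "a n * b n = d (a n) * b n + of_real \<epsilon> * (a' n * b n)" for n
      proof -
        have "of_real \<epsilon> * a' n = a n - d (a n)" using \<epsilon> by (simp add: a'_def)
        then show ?thesis unfolding mult.assoc[symmetric] by (simp add: left_diff_distrib)
      qed
      then have eq: "lincomb F (\<lambda>n. a n * b n) = lincomb F (\<lambda>n. d (a n) * b n)
          + smul (of_real \<epsilon>) (lincomb F (\<lambda>n. a' n * b n))"
        unfolding smul_lincomb lincomb_add by (intro lincomb_cong) simp
      have "f a \<le> \<kappa> * (qnorm (lincomb F (\<lambda>n. d (a n) * b n)) + \<epsilon> * f a')"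
        unfolding f_def eq using \<epsilon> by (intro order_trans[OF \<kappa>(2)]) (simp add: qnorm_smul)
      also have "\<dots> \<le> \<kappa> * (L0 * qnorm (lincomb F b) + \<epsilon> * S)"
        using \<kappa>(1) \<epsilon> a upper[OF \<open>a' \<in> Q\<close>] discrete[OF F, of a b]
        by (intro mult_left_mono add_mono) (auto simp: Q_def)
      also have "\<dots> = \<kappa> * L0 * qnorm (lincomb F b) + S / 2"
        using \<kappa>(1) by (simp add: \<epsilon>_def field_simps)
      finally show ?thesis .
    qed
    moreover have "Q \<noteq> {}" by (auto simp: Q_def intro: exI[of _ "\<lambda>_. 0"])
    ultimately have "S \<le> \<kappa> * L0 * qnorm (lincomb F b) + S / 2"
      unfolding S_def by (intro cSUP_least) auto
    then have "S \<le> 2 * \<kappa> * L0 * qnorm (lincomb F b)" by simp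
    also have "\<dots> \<le> L * qnorm (lincomb F b)"
      unfolding L_def using qnorm_nonneg by (intro mult_right_mono) auto
    finally show ?thesis using upper[of a] a by (simp add: Q_def f_def)
  qed
  then show thesis using that[of L] by (auto simp: L_def)
qed

section \<open>Democracy implies greediness\<close>

text \<open>Let \<open>A\<close> be the support of an approximant and \<open>\<Gamma>\<close> a greedy set of the same size. Off \<open>A \<union> \<Gamma>\<close> the
  greedy residual is a projection of the approximation error; its part on \<open>A - \<Gamma>\<close> is dominated, by
  democracy, by the part of \<open>x\<close> on \<open>\<Gamma> - A\<close>, where \<open>x\<close> agrees with the error.\<close>

lemma democratic_imp_greedy:
  assumes "0 < D" and dem: "sparse_democratic 1 D"
  shows "greedy_basis smul qnorm e e'"
proof -
  obtain L where L: "1 \<le> L"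
    and mult: "\<And>F a b. finite F \<Longrightarrow> (\<And>n. n \<in> F \<Longrightarrow> norm (a n) \<le> 1)
      \<Longrightarrow> qnorm (lincomb F (\<lambda>n. a n * b n)) \<le> L * qnorm (lincomb F b)"
    using multiplier_bound by blast
  \<comment> \<open>The two inner summands bound the residual off \<open>A \<union> \<Gamma>\<close>
    and on \<open>A - \<Gamma>\<close>; the outer \<open>\<kappa>\<close> joins them.\<close>
  define G where "G = \<kappa> * (\<kappa> * (1 + K) + L * D * L * K)"
  have "0 < G"
    unfolding G_def using \<kappa>(1) K(1) L \<open>0 < D\<close>
    by (intro mult_pos_pos add_pos_pos) auto
  have main: "qnorm (x - proj \<Gamma> x) \<le> G * qnorm (x - lincomb A b)"
    if \<Gamma>: "greedy_set e' x \<Gamma>" and A: "finite A" "card A = card \<Gamma>" for x \<Gamma> A b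
  proof -
    define y where "y = x - lincomb A b"
    have fin: "finite \<Gamma>" "finite (A \<union> \<Gamma>)" "finite (A - \<Gamma>)" "finite (\<Gamma> - A)"
      using \<Gamma> A by (auto simp: greedy_set_def)
    have cards: "card (\<Gamma> - A) = card (A - \<Gamma>)"
      using fin A by (simp add: card_Diff_subset_Int Int_commute)
    have y_off: "e' n y = e' n x" if "n \<notin> A" for n
      using A that by (simp add: y_def)
    have "proj (A \<union> \<Gamma>) (lincomb A b) = lincomb A b"
      using A fin by (subst proj_lincomb) (auto simp: Int_absorb1)
    then have "y - proj (A \<union> \<Gamma>) y = x - proj (A \<union> \<Gamma>) x"
      unfolding y_def proj_diff by simp
    moreover have "proj (A \<union> \<Gamma>) x = proj \<Gamma> x + proj (A - \<Gamma>) x"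
      unfolding proj_eq_lincomb using fin
      by (subst lincomb_Un[symmetric]) (auto simp: Un_commute)
    ultimately have split: "x - proj \<Gamma> x = (y - proj (A \<union> \<Gamma>) y) + proj (A - \<Gamma>) x" by simp
    have tail: "qnorm (proj (A - \<Gamma>) x) \<le> L * D * L * K * qnorm y"
    proof (cases "A - \<Gamma> = {}")
      case True
      then show ?thesis
        using L \<open>0 < D\<close> K(1) qnorm_nonneg[of y] qnorm_eq_0_iff[of 0]
        unfolding proj_eq_lincomb True lincomb_empty by (auto intro!: mult_nonneg_nonneg)
    next
      case False
      then have ne: "\<Gamma> - A \<noteq> {}" using cards fin by (metis card_eq_0_iff)
      \<comment> \<open>By greediness, this level separates the coefficients on
        \<open>A - \<Gamma>\<close> from those on \<open>\<Gamma> - A\<close>, so both parts can be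
        compared with \<open>t\<close> times an indicator.\<close>
      define t where "t = Min ((\<lambda>n. norm (e' n x)) ` (\<Gamma> - A))"
      have t: "t \<le> norm (e' n x)" if "n \<in> \<Gamma> - A" for n
        unfolding t_def using fin that by auto
      have "t \<in> (\<lambda>n. norm (e' n x)) ` (\<Gamma> - A)"
        unfolding t_def using fin ne by (intro Min_in) auto
      then obtain i where i: "i \<in> \<Gamma> - A" "t = norm (e' i x)" by blast
      then have t': "norm (e' n x) \<le> t" if "n \<in> A - \<Gamma>" for n
        using \<Gamma> that by (auto simp: greedy_set_def)
      have t0: "0 \<le> t" using i by simp
      \<comment> \<open>For \<open>t = 0\<close> the coefficients on \<open>A - \<Gamma>\<close>
        vanish, and the identity survives the division by zero.\<close>
      have "qnorm (proj (A - \<Gamma>) x) = qnorm (lincomb (A - \<Gamma>) (\<lambda>n. (e' n x / of_real t) * of_real t))"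
        unfolding proj_eq_lincomb using t' by (intro arg_cong[of _ _ qnorm] lincomb_cong) force
      also have "\<dots> \<le> L * qnorm (lincomb (A - \<Gamma>) (\<lambda>n. of_real t))"
        using fin t' t0 by (intro mult) (auto simp: norm_divide divide_le_eq_1)
      also have "lincomb (A - \<Gamma>) (\<lambda>n. of_real t) = smul (of_real t) (indic (A - \<Gamma>))"
        by (simp add: smul_lincomb)
      also have "qnorm \<dots> = t * qnorm (indic (A - \<Gamma>))"
        using t0 by (simp add: qnorm_smul)
      finally have l1: "qnorm (proj (A - \<Gamma>) x) \<le> L * (t * qnorm (indic (A - \<Gamma>)))"
        by simp
      have "qnorm (indic (A - \<Gamma>)) \<le> D * qnorm (indic (\<Gamma> - A))"
      proof -
        have "1 \<le> card (A - \<Gamma>)" using False fin by (simp add: Suc_le_eq card_gt_0_iff)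
        moreover have "(\<Gamma> - A) \<inter> (A - \<Gamma>) = {}" by auto
        ultimately show ?thesis using dem fin cards unfolding sparse_democratic_def by simp
      qed
      then have "L * (t * qnorm (indic (A - \<Gamma>))) \<le> L * (t * (D * qnorm (indic (\<Gamma> - A))))"
        using L t0 by (intro mult_left_mono) auto
      with l1 have "qnorm (proj (A - \<Gamma>) x) \<le> L * (t * (D * qnorm (indic (\<Gamma> - A))))"
        by linarith
      also have "t * (D * qnorm (indic (\<Gamma> - A))) = D * qnorm (smul (of_real t) (indic (\<Gamma> - A)))"
        using t0 by (simp add: qnorm_smul)
      also have "smul (of_real t) (indic (\<Gamma> - A))
          = lincomb (\<Gamma> - A) (\<lambda>n. (of_real t / e' n x) * e' n x)"
        unfolding smul_lincomb using t t0 by (intro lincomb_cong) force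
      also have "L * (D * qnorm \<dots>) \<le> L * (D * (L * qnorm (lincomb (\<Gamma> - A) (\<lambda>n. e' n x))))"
        using L \<open>0 < D\<close> fin t t0
        by (intro mult_left_mono mult) (auto simp: norm_divide divide_le_eq_1)
      also have "lincomb (\<Gamma> - A) (\<lambda>n. e' n x) = proj (\<Gamma> - A) y"
        unfolding proj_eq_lincomb using y_off by (intro lincomb_cong) auto
      also have "L * (D * (L * qnorm \<dots>)) \<le> L * (D * (L * (K * qnorm y)))"
        using L \<open>0 < D\<close> fin by (intro mult_left_mono K) auto
      finally show ?thesis by (simp add: mult.assoc)
    qed
    have "qnorm (x - proj \<Gamma> x) \<le> \<kappa> * (qnorm (y - proj (A \<union> \<Gamma>) y) + qnorm (proj (A - \<Gamma>) x))"
      unfolding split by (rule \<kappa>(2))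
    also have "\<dots> \<le> \<kappa> * (\<kappa> * (1 + K) * qnorm y + L * D * L * K * qnorm y)"
      using \<kappa>(1) tail qnorm_proj_compl[OF fin(2)] by (intro mult_left_mono add_mono) auto
    also have "\<dots> = G * qnorm y" by (simp add: G_def algebra_simps)
    finally show ?thesis unfolding y_def .
  qed
  have "greedy_error smul qnorm e e' m x \<le> G * best_error smul qnorm e m x" for x m
  proof -
    have "greedy_error smul qnorm e e' m x / G \<le> best_error smul qnorm e m x"
      unfolding best_error_def
    proof (rule cInf_greatest)
      show "{qnorm (x - (\<Sum>n\<in>A. smul (b n) (e n))) |A b. finite A \<and> card A = m} \<noteq> {}"
        using best_error_set_nonempty[of m] by auto
      fix z assume "z \<in> {qnorm (x - (\<Sum>n\<in>A. smul (b n) (e n))) |A b. finite A \<and> card A = m}"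
      then obtain A b where A: "finite A" "card A = m" and z: "z = qnorm (x - lincomb A b)"
        by (auto simp: lincomb_def)
      have "greedy_error smul qnorm e e' m x \<le> G * z"
        unfolding greedy_error_eq_SUP z using ex_greedy_set[of x m] A
        by (intro cSUP_least main) auto
      then show "greedy_error smul qnorm e e' m x / G \<le> z"
        using \<open>0 < G\<close> by (simp add: field_simps)
    qed
    then show ?thesis using \<open>0 < G\<close> by (simp add: field_simps)
  qed
  then show ?thesis
    unfolding greedy_basis_def using \<open>0 < G\<close> best_error_le_greedy_error
    by (intro exI[of _ 1] conjI exI[of _ G]) auto
qed

section \<open>From sparse democracy to democracy\<close>

text \<open>Peeling off one piece of size at most \<open>s\<close> at a time costs a factor
  \<open>2 * \<kappa>\<close> per piece.\<close>

lemma qnorm_indic_pieces: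
  assumes "0 \<le> T" and piece: "\<And>S. S \<subseteq> B \<Longrightarrow> card S \<le> s \<Longrightarrow> qnorm (indic S) \<le> T"
  shows "finite B \<Longrightarrow> card B \<le> j * s \<Longrightarrow> qnorm (indic B) \<le> (2 * \<kappa>) ^ j * T"
  using piece
proof (induction j arbitrary: B)
  case 0
  then show ?case using \<open>0 \<le> T\<close> qnorm_eq_0_iff[of 0] by simp
next
  case (Suc j)
  obtain S where S: "S \<subseteq> B" "card S \<le> s" "card (B - S) \<le> j * s"
  proof (cases "card B \<le> s")
    case True
    then show thesis using that[of B] by simp
  next
    case False
    then obtain S where "S \<subseteq> B" "card S = s" using obtain_subset_with_card_n[of s B] by auto
    then show thesis using that[of S] Suc.prems by (simp add: card_Diff_subset finite_subset)
  qed
  have le: "T \<le> (2 * \<kappa>) ^ j * T"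
    using mult_right_mono[OF one_le_power[of "2 * \<kappa>" j] \<open>0 \<le> T\<close>] \<kappa>(1) by simp
  have "indic B = indic (B - S) + indic S"
    using S Suc.prems by (subst lincomb_Un[symmetric]) (auto simp: finite_subset Un_absorb2)
  then have "qnorm (indic B) \<le> \<kappa> * (qnorm (indic (B - S)) + qnorm (indic S))"
    using \<kappa>(2) by simp
  also have "\<dots> \<le> \<kappa> * ((2 * \<kappa>) ^ j * T + (2 * \<kappa>) ^ j * T)"
  proof (intro mult_left_mono add_mono)
    show "qnorm (indic (B - S)) \<le> (2 * \<kappa>) ^ j * T"
      using S Suc.prems by (intro Suc.IH) auto
    show "qnorm (indic S) \<le> (2 * \<kappa>) ^ j * T"
      using Suc.prems(3)[OF S(1,2)] le by linarith
  qed (use \<kappa> in auto)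
  finally show ?case by (simp add: algebra_simps)
qed

text \<open>Cutting \<open>B\<close> into boundedly many pieces removes the loss in cardinality.\<close>

lemma sparse_democratic_imp_democratic:
  assumes M: "1 \<le> M" and D: "0 < D" and dem: "sparse_democratic M D"
  shows "\<exists>D'>0. sparse_democratic 1 D'"
proof -
  \<comment> \<open>The first entry serves pieces small enough for sparse democracy inside
    \<open>A\<close>; the second serves single vectors, which are comparable because the basis is
    seminormalized.\<close>
  define E where "E = max (D * K) (C / c * K)"
  have E: "0 < E" "D * K \<le> E" "C / c * K \<le> E"
    using D K(1) by (auto simp: E_def less_max_iff_disj)
  have small: "qnorm (indic S) \<le> E * qnorm (indic A)"
    if S: "finite A" "finite S" "A \<inter> S = {}" "A \<noteq> {}" and le: "card S \<le> max 1 (card A div M)" for A S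
  proof -
    consider "S = {}" | "card S = 1" | "1 \<le> card S" "card S \<le> card A div M"
    proof -
      have "card S = 0 \<or> card S = 1 \<or> 1 \<le> card S \<and> card S \<le> card A div M"
        using le by linarith
      then show thesis using that S(2) by auto
    qed
    then show ?thesis
    proof cases
      case 1
      then show ?thesis using E qnorm_nonneg qnorm_eq_0_iff[of 0] by simp
    next
      case 2
      then obtain i where i: "S = {i}" by (auto simp: card_1_singleton_iff)
      obtain j where j: "j \<in> A" using S by auto
      have "c \<le> qnorm (indic {j})" using c by (simp add: lincomb_def)
      also have "\<dots> \<le> K * qnorm (indic A)" using S j by (intro qnorm_lincomb_subset) auto
      finally have "C / c * c \<le> C / c * (K * qnorm (indic A))"
        using c C by (intro mult_left_mono) auto
      then have "qnorm (indic S) \<le> C / c * K * qnorm (indic A)"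
        using C(2)[of i] c by (simp add: i lincomb_def mult.assoc)
      also have "\<dots> \<le> E * qnorm (indic A)" using E qnorm_nonneg by (intro mult_right_mono) auto
      finally show ?thesis .
    next
      case 3
      then have "M * card S \<le> card A"
        using M by (metis less_eq_div_iff_mult_less_eq mult.commute less_le_trans zero_less_one)
      then obtain A' where A': "A' \<subseteq> A" "card A' = M * card S" "finite A'"
        using obtain_subset_with_card_n by blast
      have "qnorm (indic S) \<le> D * qnorm (indic A')"
        using A' S 3 dem unfolding sparse_democratic_def by blast
      also have "\<dots> \<le> D * (K * qnorm (indic A))"
        using D S A' by (intro mult_left_mono qnorm_lincomb_subset) auto
      also have "\<dots> \<le> E * qnorm (indic A)"
        unfolding mult.assoc[symmetric] using E qnorm_nonneg by (intro mult_right_mono) auto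
      finally show ?thesis .
    qed
  qed
  have "qnorm (indic B) \<le> (2 * \<kappa>) ^ (2 * M) * E * qnorm (indic A)"
    if AB: "finite A" "finite B" "card A = card B" "A \<inter> B = {}" for A B
  proof (cases "A = {}")
    case True
    then have "B = {}" using AB by simp
    then show ?thesis using True qnorm_eq_0_iff[of 0] by simp
  next
    case False
    \<comment> \<open>With this size \<open>2 * M\<close> pieces suffice: the remainder of the
      division is below \<open>M\<close>, and if \<open>card A < M\<close>, single vectors are
      used.\<close>
    define s where "s = max 1 (card A div M)"
    have "card B \<le> 2 * M * s"
    proof (cases "card A < M")
      case True
      then show ?thesis using AB by (simp add: s_def)
    next
      case False
      then have "1 \<le> card A div M" using M by (simp add: div_greater_zero_iff Suc_le_eq)
      then have "M \<le> M * (card A div M)" "s = card A div M" by (auto simp: s_def)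
      moreover have "card A = M * (card A div M) + card A mod M" by simp
      moreover have "card A mod M < M" using M by simp
      ultimately have "card A \<le> 2 * (M * (card A div M))" by linarith
      then show ?thesis using AB \<open>s = card A div M\<close> by (simp add: mult.assoc)
    qed
    moreover have "qnorm (indic S) \<le> E * qnorm (indic A)" if "S \<subseteq> B" "card S \<le> s" for S
      using that AB False finite_subset[OF that(1)] by (intro small) (auto simp: s_def)
    ultimately have "qnorm (indic B) \<le> (2 * \<kappa>) ^ (2 * M) * (E * qnorm (indic A))"
      using AB E qnorm_nonneg by (intro qnorm_indic_pieces[of _ B s]) auto
    then show ?thesis by (simp add: mult.assoc)
  qed
  moreover have "0 < (2 * \<kappa>) ^ (2 * M) * E" using E \<kappa>(1) by simp
  ultimately show ?thesis
    unfolding sparse_democratic_def by (intro exI[of _ "(2 * \<kappa>) ^ (2 * M) * E"]) simp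
qed

section \<open>Sparse democracy from the embedding of classes\<close>

text \<open>Test the embedding on \<open>x = 1\<^sub>A + 1\<^sub>B\<close> with \<open>|A| = M |B|\<close>. A greedy algorithm may select \<open>A\<close>
  first, so that \<open>x\<close> keeps a greedy error of the order of \<open>\<parallel>1\<^sub>B\<parallel>\<close> up to step \<open>|A|\<close>, while removing
  \<open>B\<close> first leaves only \<open>1\<^sub>A\<close> after step \<open>|B|\<close>. For large \<open>M\<close> the growth of the weight makes the
  contribution of the first \<open>|B|\<close> steps negligible.\<close>

lemma embedding_imp_sparse_democratic:
  assumes w: "\<omega> \<in> doubling_weights" and i: "0 < lower_dilation_index \<omega>" and q: "0 < q"
    and emb: "class_embeds (approximation_class_norm smul qnorm e q \<omega>)
      (greedy_class_norm smul qnorm e e' q \<omega>)"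
  shows "\<exists>M\<ge>1. \<exists>D>0. sparse_democratic M D"
proof -
  obtain V \<Theta> Q where "weighted_step_norm q \<omega> V \<Theta> Q"
    using ex_weighted_step_norm[OF w i q] by blast
  then interpret weighted_step_norm q \<omega> V \<Theta> Q .
  obtain C0 where C0: "0 < C0"
    and emb': "\<And>x. approximation_class_norm smul qnorm e q \<omega> x < \<infinity> \<Longrightarrow>
      greedy_class_norm smul qnorm e e' q \<omega> x \<le> ennreal C0 * approximation_class_norm smul qnorm e q \<omega> x"
    using emb unfolding class_embeds_def finiteness_class_def by blast
  have Vpos: "0 < V n" if "1 \<le> n" for n using V_mono[OF order_refl that] V1 by linarith
  have \<Theta>: "0 < \<Theta>"
    using V_doubling[of 1] Vpos[of 1] Vpos[of 2]
    by (metis less_le_trans mult.right_neutral one_le_numeral order_refl zero_less_mult_pos2)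
  \<comment> \<open>\<open>P\<close> collects the terms carrying the quasi-norm of the test vector,
    with \<open>1 / V 1\<close> turning its bare occurrence into a multiple of \<open>V k\<close>;
    \<open>P'\<close> collects those carrying the quasi-norm of \<open>indic A\<close>.\<close>
  define P where "P = C0 * (1 / V 1 + Q)"
  define P' where "P' = C0 * Q * \<Theta>"
  have P: "0 < P" "0 < P'"
    unfolding P_def P'_def using C0 V1 Q \<Theta> by (auto intro!: mult_pos_pos add_pos_pos)
  \<comment> \<open>This ratio bounds the terms with \<open>P\<close> by
    \<open>V N * ((na + nb) / (2 * K))\<close>, so half of the lower bound \<open>nb / K\<close>
    survives the absorption.\<close>
  obtain M where M: "1 \<le> M" "\<And>k. 1 \<le> k \<Longrightarrow> 2 * K * \<kappa> * P * V k \<le> V (M * k)"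
    using V_growth by blast
  have "qnorm (indic B) \<le> (1 + 2 * K * P') * qnorm (indic A)"
    if AB: "finite A" "finite B" "1 \<le> card B" "card A = M * card B" "A \<inter> B = {}" for A B
  proof -
    define k where "k = card B"
    define N where "N = M * k"
    have k: "1 \<le> k" "k \<le> N" "1 \<le> N" "card (A \<union> B) \<le> 2 * N"
      using AB M(1) by (auto simp: k_def N_def card_Un_disjoint Suc_le_eq)
    define x where "x = indic (A \<union> B)"
    have x: "x = indic A + indic B" unfolding x_def using AB by (intro lincomb_Un) auto
    define na where "na = qnorm (indic A)"
    define nb where "nb = qnorm (indic B)"
    define nx where "nx = qnorm x"
    have nonneg: "0 \<le> na" "0 \<le> nb" "0 \<le> nx" by (auto simp: na_def nb_def nx_def qnorm_nonneg)
    have nx: "nx \<le> \<kappa> * (na + nb)" unfolding nx_def na_def nb_def x by (rule \<kappa>)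
    \<comment> \<open>All coefficients on \<open>A \<union> B\<close> equal 1, so every subset of
      \<open>A\<close> is a greedy set; the residual still contains \<open>indic B\<close>, which
      projecting onto \<open>B\<close> recovers.\<close>
    have lower: "nb / K \<le> greedy_error smul qnorm e e' n x" if n: "n \<le> N" for n
    proof -
      obtain \<Gamma> where \<Gamma>: "\<Gamma> \<subseteq> A" "card \<Gamma> = n" "finite \<Gamma>"
        using obtain_subset_with_card_n[of n A] n AB by (auto simp: N_def k_def)
      have "greedy_set e' x \<Gamma>"
        using \<Gamma> AB by (auto simp: greedy_set_def x_def)
      have "proj B (x - proj \<Gamma> x) = lincomb (B \<inter> (A \<union> B)) (\<lambda>_. 1) - lincomb (B \<inter> (\<Gamma> \<inter> (A \<union> B))) (\<lambda>_. 1)"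
        unfolding proj_diff x_def using AB \<Gamma> by (simp add: proj_lincomb)
      also have "B \<inter> (\<Gamma> \<inter> (A \<union> B)) = {}" using \<Gamma> AB by auto
      also have "B \<inter> (A \<union> B) = B" by auto
      finally have "nb = qnorm (proj B (x - proj \<Gamma> x))" by (simp add: nb_def)
      also have "\<dots> \<le> K * qnorm (x - proj \<Gamma> x)" using AB by (intro K)
      also have "\<dots> \<le> K * greedy_error smul qnorm e e' n x"
        using greedy_error_ge[OF \<open>greedy_set e' x \<Gamma>\<close>] \<Gamma>(2) K(1) by (intro mult_left_mono) auto
      finally show ?thesis using K(1) by (simp add: field_simps)
    qed
    have "ennreal (nb / K * V N) \<le> weighted_lq_norm q \<omega> (\<lambda>n. greedy_error smul qnorm e e' n x)"
      using k nonneg K(1) lower by (intro V_lower) auto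
    also have "\<dots> \<le> greedy_class_norm smul qnorm e e' q \<omega> x"
      unfolding greedy_class_norm_def error_class_norm_def by simp
    finally have G: "ennreal (nb / K * V N) \<le> greedy_class_norm smul qnorm e e' q \<omega> x" .
    define T where "T = nx + Q * (nx * V k + na * V (2 * N))"
    have T: "0 \<le> T"
      unfolding T_def using nonneg Q Vpos[of k] Vpos[of "2 * N"] k by auto
    \<comment> \<open>Three regimes of approximation: nothing removed, \<open>B\<close> removed from
      step \<open>k\<close> on, everything removed from step \<open>2 * N\<close> on.\<close>
    have "weighted_lq_norm q \<omega> (\<lambda>n. best_error smul qnorm e n x)
        \<le> ennreal (Q * (nx * V k + na * V (2 * N)))"
    proof (rule V_upper)
      fix n :: nat
      show "0 \<le> best_error smul qnorm e n x \<and> best_error smul qnorm e n x \<le> nx"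
        using best_error_nonneg best_error_le[of "{}" n x] by (simp add: nx_def)
      show "best_error smul qnorm e n x \<le> na" if "k \<le> n"
        using best_error_le[of B n x "\<lambda>_. 1"] that AB by (simp add: na_def x k_def)
      show "best_error smul qnorm e n x = 0" if "2 * N \<le> n"
        using best_error_le[of "A \<union> B" n x "\<lambda>_. 1"] best_error_nonneg[of n x] that AB k
        by (simp add: x_def)
    qed (use k nonneg in auto)
    then have A: "approximation_class_norm smul qnorm e q \<omega> x \<le> ennreal T"
      unfolding approximation_class_norm_def error_class_norm_def T_def nx_def[symmetric]
      using nonneg Q Vpos[of k] Vpos[of "2 * N"] k
      by (subst ennreal_plus) (auto intro: add_left_mono)
    then have "approximation_class_norm smul qnorm e q \<omega> x < \<infinity>"
      by (simp add: le_less_trans[OF _ ennreal_less_top])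
    from emb'[OF this] G
    have "ennreal (nb / K * V N) \<le> ennreal C0 * approximation_class_norm smul qnorm e q \<omega> x"
      by (rule order_trans[rotated])
    also have "\<dots> \<le> ennreal C0 * ennreal T" using A by (intro mult_left_mono) auto
    also have "\<dots> = ennreal (C0 * T)" using C0 T by (simp add: ennreal_mult)
    finally have main: "nb / K * V N \<le> C0 * T" using C0 T by simp
    have "nx * 1 \<le> nx * (V k / V 1)"
      using nonneg V_mono[OF order_refl k(1)] V1 by (intro mult_left_mono) auto
    then have "T \<le> nx * (V k / V 1) + Q * (nx * V k + na * (\<Theta> * V N))"
      unfolding T_def using Q nonneg V_doubling[OF k(3)]
      by (intro add_mono mult_left_mono) auto
    then have "C0 * T \<le> C0 * (nx * (V k / V 1) + Q * (nx * V k + na * (\<Theta> * V N)))"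
      using C0 by (intro mult_left_mono) auto
    also have "\<dots> = P * V k * nx + P' * na * V N"
      by (simp add: P_def P'_def algebra_simps)
    also have "P * V k * nx \<le> P * V k * (\<kappa> * (na + nb))"
      using nx P Vpos[OF k(1)] by (intro mult_left_mono) auto
    also have "P * V k * (\<kappa> * (na + nb)) = (2 * K * \<kappa> * P * V k) * ((na + nb) / (2 * K))"
      using K(1) by (simp add: field_simps)
    also have "\<dots> \<le> V N * ((na + nb) / (2 * K))"
      using M(2)[OF k(1)] nonneg K(1) unfolding N_def by (intro mult_right_mono) auto
    finally have "V N * (nb / K) \<le> V N * ((na + nb) / (2 * K) + P' * na)"
      using main by (simp add: algebra_simps)
    then have "nb / K \<le> (na + nb) / (2 * K) + P' * na"
      using Vpos[OF k(3)] by (simp only: mult_le_cancel_left_pos)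
    then have "nb \<le> (1 + 2 * K * P') * na"
      using K(1) by (simp add: field_simps)
    then show ?thesis by (simp add: na_def nb_def)
  qed
  then have "sparse_democratic M (1 + 2 * K * P')" unfolding sparse_democratic_def by blast
  moreover have "0 < 1 + 2 * K * P'" using K(1) P by (simp add: add_pos_pos)
  ultimately show ?thesis using M(1) by blast
qed

end

section \<open>Constants of an unconditional basis and the equivalence of classes\<close>

lemma (in M_basis) unconditional_basis_bound:
  assumes "unconditional_basis smul qnorm e e'"
  shows "\<exists>K\<ge>1. \<forall>A x. finite A \<longrightarrow> qnorm (proj A x) \<le> K * qnorm x"
proof -
  define S where "S = (SUP A\<in>{A. finite A}. operator_qnorm qnorm (proj A))"
  have "S < \<infinity>" using assms by (simp add: unconditional_basis_def S_def)
  then obtain s where s: "0 \<le> s" "S = ennreal s" by (cases S) auto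
  have "qnorm (proj A x) \<le> max 1 s * qnorm x" if A: "finite A" for A x
  proof (cases "x = 0")
    case True
    then show ?thesis by (simp add: proj_eq_lincomb lincomb_def)
  next
    case False
    define y where "y = smul (of_real (1 / qnorm x)) x"
    have "ennreal (qnorm (proj A y)) \<le> operator_qnorm qnorm (proj A)"
      unfolding operator_qnorm_def using qnorm_scaled[OF False] by (intro SUP_upper) (auto simp: y_def)
    also have "\<dots> \<le> ennreal s" unfolding s(2)[symmetric] S_def using A by (intro SUP_upper) auto
    finally have "qnorm (proj A y) \<le> s" using s by simp
    moreover have "proj A y = smul (of_real (1 / qnorm x)) (proj A x)"
      by (simp add: y_def proj_eq_lincomb smul_lincomb)
    moreover have "0 < qnorm x" using False qnorm_nonneg[of x] qnorm_eq_0_iff[of x] by simp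
    ultimately have "qnorm (proj A x) \<le> s * qnorm x"
      by (simp add: qnorm_smul norm_divide field_simps)
    also have "\<dots> \<le> max 1 s * qnorm x" using qnorm_nonneg by (intro mult_right_mono) auto
    finally show ?thesis .
  qed
  then show ?thesis by (intro exI[of _ "max 1 s"]) simp
qed

lemma (in M_basis) unconditional_constants:
  assumes "unconditional_basis smul qnorm e e'"
  shows "\<exists>\<kappa> K c C. unconditional_M_basis smul qnorm e e' \<kappa> K c C"
proof -
  obtain \<kappa> where \<kappa>: "1 \<le> \<kappa>" "\<And>x y. qnorm (x + y) \<le> \<kappa> * (qnorm x + qnorm y)"
    using qnorm_triangle by blast
  obtain K where K: "1 \<le> K" "\<And>A x. finite A \<Longrightarrow> qnorm (proj A x) \<le> K * qnorm x"
    using unconditional_basis_bound[OF assms] by blast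
  obtain c C where c: "0 < c" "\<And>n. c \<le> qnorm (e n)" "\<And>n. qnorm (e n) \<le> C"
    "\<And>n. dual_norm qnorm (e' n) \<le> ennreal C"
    using seminormalized by blast
  then have "0 < C" by (meson less_le_trans)
  then have "norm (e' n x) \<le> C * qnorm x" for n x
    using c(4) functionals by (intro norm_functional_le) auto
  then have "unconditional_M_basis smul qnorm e e' \<kappa> K c C"
    using \<kappa> K c \<open>0 < C\<close> by unfold_locales auto
  then show ?thesis by blast
qed

theorem theorem1p4:
  fixes smul :: "'k::{real_normed_field, heine_borel} \<Rightarrow> 'v::ab_group_add \<Rightarrow> 'v"
    and qnorm :: "'v \<Rightarrow> real"
    and e :: "nat \<Rightarrow> 'v" and e' :: "nat \<Rightarrow> 'v \<Rightarrow> 'k"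
    and \<omega> :: "nat \<Rightarrow> real"
  assumes "\<omega> \<in> doubling_weights"
    and "0 < lower_dilation_index \<omega>"
    and "M_basis smul qnorm e e'"
    and "unconditional_basis smul qnorm e e'"
  shows "(greedy_basis smul qnorm e e' \<longrightarrow>
      (\<forall>q::ennreal. 0 < q \<longrightarrow>
        class_equivalent (approximation_class_norm smul qnorm e q \<omega>)
          (greedy_class_norm smul qnorm e e' q \<omega>))) \<and>
    ((\<exists>q::ennreal. 0 < q \<and>
        class_equivalent (approximation_class_norm smul qnorm e q \<omega>)
          (greedy_class_norm smul qnorm e e' q \<omega>)) \<longrightarrow>
      greedy_basis smul qnorm e e')"
proof (intro conjI impI allI)
  interpret M_basis smul qnorm e e' by fact
  obtain \<kappa> K c C where "unconditional_M_basis smul qnorm e e' \<kappa> K c C"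
    using unconditional_constants[OF assms(4)] by blast
  then interpret unconditional_M_basis smul qnorm e e' \<kappa> K c C .
  have W: "\<omega> \<in> weights" using assms(1) by (simp add: doubling_weights_def)
  {
    fix q :: ennreal
    assume q: "0 < q" and "greedy_basis smul qnorm e e'"
    then obtain G where G: "0 < G"
      "\<And>x m. 1 \<le> m \<Longrightarrow> greedy_error smul qnorm e e' m x \<le> G * best_error smul qnorm e m x"
      unfolding greedy_basis_def by blast
    have "0 \<le> greedy_error smul qnorm e e' m x" for m x
      using best_error_nonneg best_error_le_greedy_error order_trans by blast
    then show "class_equivalent (approximation_class_norm smul qnorm e q \<omega>)
        (greedy_class_norm smul qnorm e e' q \<omega>)"
      unfolding class_equivalent_def approximation_class_norm_def greedy_class_norm_def
      using G best_error_nonneg best_error_le_greedy_error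
      by (intro conjI error_class_embeds[OF W q, of G] error_class_embeds[OF W q, of 1]) auto
  next
    assume "\<exists>q::ennreal. 0 < q \<and> class_equivalent (approximation_class_norm smul qnorm e q \<omega>)
        (greedy_class_norm smul qnorm e e' q \<omega>)"
    then obtain q :: ennreal where "0 < q"
      and "class_embeds (approximation_class_norm smul qnorm e q \<omega>)
        (greedy_class_norm smul qnorm e e' q \<omega>)"
      unfolding class_equivalent_def by blast
    then obtain M D where "1 \<le> M" "0 < D" "sparse_democratic M D"
      using embedding_imp_sparse_democratic[OF assms(1,2)] by blast
    then obtain D' where "0 < D'" "sparse_democratic 1 D'"
      using sparse_democratic_imp_democratic by blast
    then show "greedy_basis smul qnorm e e'" by (rule democratic_imp_greedy)
  }
qed

end
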